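(* Let $n\ge2$, $\delta,\tau\in(0,1)$, $1\le s\le\frac{n}{n-\delta}$, $1\le q\le\frac{n}{s(n-\delta)}$ and $\alpha=n-qs(n-\delta)$. Let $\Omega\subset\mathbb{R}^n$ be an $s$-distance John domain with John constant $C_J\ge1$, and let $\mu$ be a (nonnegative) Radon measure on $\mathbb{R}^n$. Assume that there exists a constant $C_\mu\ge1$ such that $$\mu(B(x,r))\le C_\mu r^{n-\alpha}$$ for every ball $B(x,r)\subset\mathbb{R}^n$. Then there exists a constant $C>0$ depending only on $n,\tau,s,C_\mu,C_J$ and $\operatorname{diam}\Omega$ such that for every $f\in L^1(\Omega)$, $$\left(\int_\Omega|f^*-f_\Omega|^q\,d\mu\right)^{1/q}\le C(1-\delta)\int_\Omega\int_{\{x\in\Omega:\,|x-y|<\tau d(y)\}}\frac{|f(x)-f(y)|}{|x-y|^{n+\delta}}\,dx\,dy.$$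
   Context: A domain is a nonempty open connected set; $d(x)=\operatorname{dist}(x,\partial\Omega)$; $f_\Omega=\frac1{|\Omega|}\int_\Omega f\,dx$. A bounded domain $\Omega\subset\mathbb{R}^n$ is an $s$-distance John domain ($s\ge1$) with John constant $C_J\ge 1$ and John center $x_J\in\Omega$ if each $x\in\Omega$ can be joined to $x_J$ by a rectifiable curve $\gamma:[0,1]\to\Omega$, $\gamma(0)=x$, $\gamma(1)=x_J$, with $C_J\, d(\gamma(t))>|\gamma(t)-x|^s$ for all $t\in[0,1]$. A point $x\in\Omega$ is a Lebesgue point of $f\in L^1(\Omega)$ if there is $a\in\mathbb{R}$ with $\lim_{r\to0}\frac{1}{|B(x,r)|}\int_{B(x,r)}|f(y)-a|\,dy=0$; $\mathcal{L}_f$ is the set of Lebesgue points and the precise representative $f^*:\mathcal{L}_f\to\mathbb{R}$ is $f^*(x):=a$. Integrals over $\Omega$ involving $f^*$ are understood over $\mathcal{L}_f$. *)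

theory Defs
  imports "HOL-Analysis.Analysis"
begin

definition rectifiable :: "(real \<Rightarrow> 'a::metric_space) \<Rightarrow> bool" where
  "rectifiable \<gamma> \<longleftrightarrow> path \<gamma> \<and>
     (\<exists>L. \<forall>(N::nat) t. mono_on {..N} t \<and> t ` {..N} \<subseteq> {0..1} \<longrightarrow>
        (\<Sum>i<N. dist (\<gamma> (t i)) (\<gamma> (t (Suc i)))) \<le> L)"

definition bdist :: "'a::metric_space set \<Rightarrow> 'a \<Rightarrow> real" where
  "bdist \<Omega> x = infdist x (frontier \<Omega>)"

definition distance_John_domain ::
    "real \<Rightarrow> real \<Rightarrow> 'a::euclidean_space \<Rightarrow> 'a set \<Rightarrow> bool" where
  "distance_John_domain s C\<^sub>J x\<^sub>J \<Omega> \<longleftrightarrow>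
     1 \<le> s \<and> 1 \<le> C\<^sub>J \<and>
     \<Omega> \<noteq> {} \<and> open \<Omega> \<and> connected \<Omega> \<and> bounded \<Omega> \<and> x\<^sub>J \<in> \<Omega> \<and>
     (\<forall>x\<in>\<Omega>. \<exists>\<gamma>. rectifiable \<gamma> \<and> path_image \<gamma> \<subseteq> \<Omega> \<and>
        pathstart \<gamma> = x \<and> pathfinish \<gamma> = x\<^sub>J \<and>
        (\<forall>t\<in>{0..1}. C\<^sub>J * bdist \<Omega> (\<gamma> t) > norm (\<gamma> t - x) powr s))"

definition mean_on :: "'a::euclidean_space set \<Rightarrow> ('a \<Rightarrow> real) \<Rightarrow> real" where
  "mean_on \<Omega> f = 1 / measure lebesgue \<Omega> * (LINT x:\<Omega>|lebesgue. f x)"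

definition has_Lebesgue_value :: "('a::euclidean_space \<Rightarrow> real) \<Rightarrow> 'a \<Rightarrow> real \<Rightarrow> bool" where
  "has_Lebesgue_value f x a \<longleftrightarrow>
     ((\<lambda>r. 1 / measure lebesgue (ball x r) * (LINT y:ball x r|lebesgue. \<bar>f y - a\<bar>))
        \<longlongrightarrow> 0) (at_right 0)"

text \<open>Functions on the open set \<open>\<Omega>\<close> are total functions whose values off \<open>\<Omega>\<close> are irrelevant:
  for \<open>x \<in> \<Omega>\<close> the limit above only involves balls contained in \<open>\<Omega>\<close>.\<close>

definition Lebesgue_points :: "'a::euclidean_space set \<Rightarrow> ('a \<Rightarrow> real) \<Rightarrow> 'a set" where
  "Lebesgue_points \<Omega> f = {x\<in>\<Omega>. \<exists>a. has_Lebesgue_value f x a}"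

text \<open>Meaningful only on \<open>Lebesgue_points \<Omega> f\<close> for \<open>f\<close> integrable on \<open>\<Omega>\<close>, where the value
  is unique.\<close>

definition precise_rep :: "('a::euclidean_space \<Rightarrow> real) \<Rightarrow> 'a \<Rightarrow> real" where
  "precise_rep f x = (THE a. has_Lebesgue_value f x a)"

definition Radon_measure :: "'a::topological_space measure \<Rightarrow> bool" where
  "Radon_measure \<mu> \<longleftrightarrow>
     sets \<mu> = sets borel \<and>
     (\<forall>K. compact K \<longrightarrow> emeasure \<mu> K < \<infinity>) \<and>
     (\<forall>A\<in>sets borel. emeasure \<mu> A = (INF U\<in>{U. open U \<and> A \<subseteq> U}. emeasure \<mu> U)) \<and>
     (\<forall>U. open U \<longrightarrow> emeasure \<mu> U = (SUP K\<in>{K. compact K \<and> K \<subseteq> U}. emeasure \<mu> K))"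

text \<open>Powers of extended nonnegative reals, for positive exponents.\<close>

definition ennreal_powr :: "ennreal \<Rightarrow> real \<Rightarrow> ennreal" where
  "ennreal_powr x p = (if x = \<infinity> then \<infinity> else ennreal (enn2real x powr p))"

end

(* The left-hand side is a strong-type bound at the endpoint exponent, and it is obtained from a
   boxing inequality for sets. Let E have density at most 1/2 in a ball around the John center and
   let x be a point where E has upper density larger than 1/2. Slide a ball B(z, c d(z)) along the
   John curve from x (after shrinking balls centered at x): by the intermediate value theorem some
   ball has density exactly 1/2. In that single ball the relative isoperimetric inequality, with the
   factor 1 - delta, bounds r^(n-delta) by the local energy of E, and the John condition puts it
   inside a ball B(x, rho) with rho^s comparable to r. A Vitali covering by the balls B(x, rho)
   turns this into mu(E) <= (C (1 - delta) energy(E))^q. Functions are reduced to their superlevel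
   sets at dyadic heights by the coarea formula and the inclusion of l^1 in l^q; no chain of balls
   has to be summed, so the constant does not degenerate as q tends to 1 or delta to 0 or 1.
   The factor 1 - delta comes from a convexity argument: splitting segments at their midpoints shows
   that the oscillation at distance d / 2^k is at least 2^(-k(n+1)) times the total oscillation. *)
theory Submission
  imports Defs
begin

section \<open>Sums of powers\<close>

text \<open>Since \<open>\<mu>\<close> may be singular to Lebesgue measure, a function enters only
  through sets \<open>half_dense\<close>: they are Borel, blind to Lebesgue null sets, and contain
  every Lebesgue point whose value exceeds the level. A pointwise Borel majorant then suffices, and
  measurability of the precise representative never enters. The growth exponent is n - alpha = q s
  (n - delta): the factor s is the price of comparing rho^s with r, and the outer power q is what
  allows energies of disjoint balls to be added before the power is taken. A median over the ball
  around the John center is subtracted, not the mean, because the superlevel sets of both signs then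
  fill at most half of that ball. Replacing the median by the mean is one more use of the same
  estimate, with Lebesgue measure and q = 1. Lebesgue measure has the required growth only on
  bounded radii, hence the restriction to r <= 10 D, five times the largest covering radius 2
  D.\<close>

lemma powr_add_le_powr_add:
  fixes x y q :: real
  assumes "0 \<le> x" "0 \<le> y" "1 \<le> q"
  shows "x powr q + y powr q \<le> (x + y) powr q"
proof -
  have split: "z powr q = z * z powr (q - 1)" if "0 \<le> z" for z :: real
    using that by (cases "z = 0") (simp_all add: powr_diff)
  have "x powr q + y powr q \<le> x * (x + y) powr (q - 1) + y * (x + y) powr (q - 1)"
    using assms split[of x] split[of y] by (simp only:) (intro add_mono mult_left_mono powr_mono2; simp)
  also have "\<dots> = (x + y) powr q"
    using assms split[of "x + y"] by (simp add: distrib_right)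
  finally show ?thesis .
qed

text \<open>Every term is at most the total S, so a^q <= S^(q-1) a. This inclusion of l^1 in l^q
  serves twice: for disjoint balls in the covering and for disjoint ranges of levels.\<close>

lemma suminf_powr_le:
  fixes a :: "nat \<Rightarrow> real"
  assumes a: "\<And>n. 0 \<le> a n" and S: "0 \<le> S" "(\<Sum>n. ennreal (a n)) \<le> ennreal S" and q: "1 \<le> q"
  shows "(\<Sum>n. ennreal (a n powr q)) \<le> ennreal (S powr q)"
proof -
  have le: "a n \<le> S" for n
  proof -
    have "ennreal (a n) \<le> (\<Sum>n. ennreal (a n))"
      using sum_le_suminf[of "\<lambda>n. ennreal (a n)" "{n}"] by simp
    also note S(2)
    finally show ?thesis using S(1) by simp
  qed
  have split: "x powr q = x powr (q - 1) * x" if "0 \<le> x" for x :: real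
    using that by (cases "x = 0") (simp_all add: powr_diff)
  have "(\<Sum>n. ennreal (a n powr q)) \<le> (\<Sum>n. ennreal (S powr (q - 1)) * ennreal (a n))"
  proof (intro suminf_le summableI)
    fix n
    have "a n powr q \<le> S powr (q - 1) * a n"
      unfolding split[OF a] using a[of n] le[of n] q by (intro mult_right_mono powr_mono2) auto
    then show "ennreal (a n powr q) \<le> ennreal (S powr (q - 1)) * ennreal (a n)"
      by (metis ennreal_leI ennreal_mult' powr_ge_zero)
  qed
  also have "\<dots> = ennreal (S powr (q - 1)) * (\<Sum>n. ennreal (a n))"
    by (rule ennreal_suminf_cmult)
  also have "\<dots> \<le> ennreal (S powr (q - 1)) * ennreal S"
    by (intro mult_left_mono S) simp
  also have "\<dots> = ennreal (S powr q)"
    using S(1) by (simp add: split ennreal_mult)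
  finally show ?thesis .
qed

section \<open>Points of upper density larger than one half\<close>

lemma emeasure_ball_less_top [simp]: "emeasure lborel (ball x r :: 'a::euclidean_space set) < top"
  using emeasure_lborel_ball_finite by simp

lemma fmeasurable_ball [simp]: "ball x r \<in> fmeasurable lborel"
  by (auto intro: fmeasurableI)

text \<open>The indicators of the moving balls converge off the limiting sphere, which is null, and
  stay below a fixed ball, so dominated convergence applies. Joint continuity in center and radius
  feeds the intermediate value theorem.\<close>

lemma continuous_on_measure_Int_ball:
  fixes a :: "'t::metric_space \<Rightarrow> 'a::euclidean_space"
  assumes E: "E \<in> sets borel" and a: "continuous_on S a" and b: "continuous_on S b"
  shows "continuous_on S (\<lambda>t. measure lborel (E \<inter> ball (a t) (b t)))"
  unfolding continuous_on_sequentially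
proof (intro allI ballI impI, elim conjE)
  fix u t assume t: "t \<in> S" and "\<forall>n. u n \<in> S" and u: "u \<longlonglongrightarrow> t"
  then have au: "(\<lambda>n. a (u n)) \<longlonglongrightarrow> a t" and bu: "(\<lambda>n. b (u n)) \<longlonglongrightarrow> b t"
    using a b unfolding continuous_on_sequentially comp_def by blast+
  obtain R1 where R1: "\<And>n. norm (a (u n)) \<le> R1"
    using convergent_imp_Bseq[OF convergentI[OF au]] unfolding Bseq_def by blast
  obtain R2 where R2: "\<And>n. norm (b (u n)) \<le> R2"
    using convergent_imp_Bseq[OF convergentI[OF bu]] unfolding Bseq_def by blast
  have sub: "ball (a (u n)) (b (u n)) \<subseteq> ball 0 (R1 + R2 + 1)" for n
  proof
    fix y assume "y \<in> ball (a (u n)) (b (u n))"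
    then have "dist (a (u n)) y < b (u n)" by simp
    moreover have "norm y \<le> norm (a (u n)) + dist (a (u n)) y"
      by (metis dist_norm norm_minus_commute norm_triangle_sub)
    ultimately show "y \<in> ball 0 (R1 + R2 + 1)"
      using R1[of n] R2[of n] by (simp add: real_norm_def)
  qed
  have "(\<lambda>n. \<integral>y. indicator (E \<inter> ball (a (u n)) (b (u n))) y \<partial>lborel)
      \<longlonglongrightarrow> (\<integral>y. indicator (E \<inter> ball (a t) (b t)) y \<partial>lborel :: real)"
  proof (rule integral_dominated_convergence[where w = "indicator (ball 0 (R1 + R2 + 1))"])
    show "integrable lborel (indicator (ball 0 (R1 + R2 + 1)) :: 'a \<Rightarrow> real)"
      by (intro integrable_real_indicator) simp_all
    have "AE y in lborel. y \<notin> sphere (a t) (b t)"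
      using negligible_sphere[of "a t" "b t"]
      by (intro AE_not_in) (simp add: negligible_iff_null_sets null_sets_completion_iff)
    then show "AE y in lborel. (\<lambda>n. indicat_real (E \<inter> ball (a (u n)) (b (u n))) y)
        \<longlonglongrightarrow> indicat_real (E \<inter> ball (a t) (b t)) y"
    proof eventually_elim
      case (elim y)
      have d: "(\<lambda>n. b (u n) - dist (a (u n)) y) \<longlonglongrightarrow> b t - dist (a t) y"
        by (intro tendsto_intros au bu)
      have "eventually (\<lambda>n. (b (u n) - dist (a (u n)) y > 0) = (b t - dist (a t) y > 0)) sequentially"
      proof (cases "b t - dist (a t) y > 0")
        case True
        from order_tendstoD(1)[OF d True] show ?thesis by eventually_elim (use True in simp)
      next
        case False
        with elim have "b t - dist (a t) y < 0" by (simp add: not_less)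
        from order_tendstoD(2)[OF d this] show ?thesis by eventually_elim (use False in auto)
      qed
      then have "eventually (\<lambda>n. indicat_real (E \<inter> ball (a (u n)) (b (u n))) y
          = indicat_real (E \<inter> ball (a t) (b t)) y) sequentially"
        by eventually_elim (auto simp: indicator_def)
      then show ?case by (rule tendsto_eventually)
    qed
    show "AE y in lborel. norm (indicat_real (E \<inter> ball (a (u n)) (b (u n))) y)
        \<le> indicator (ball 0 (R1 + R2 + 1)) y" for n
      using sub[of n] by (intro AE_I2) (auto simp: indicator_def)
  qed (use E in \<open>auto intro!: borel_measurable_indicator\<close>)
  then show "((\<lambda>t. measure lborel (E \<inter> ball (a t) (b t))) \<circ> u)
      \<longlonglongrightarrow> measure lborel (E \<inter> ball (a t) (b t))"
    by (simp add: comp_def)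
qed

text \<open>Testing along countably many radii makes the set Borel; \<open>frequently\<close> asks
  only for arbitrarily small good radii, which is all that the intermediate value argument
  needs.\<close>

definition half_dense :: "'a::euclidean_space set \<Rightarrow> 'a set" where
  "half_dense E = {x. \<exists>\<^sub>F k in sequentially.
     measure lborel (ball x (1 / Suc k)) < 2 * measure lborel (E \<inter> ball x (1 / Suc k))}"

lemma borel_measurable_measure_Int_ball:
  fixes E :: "'a::euclidean_space set"
  assumes "E \<in> sets borel"
  shows "(\<lambda>x. measure lborel (E \<inter> ball x r)) \<in> borel_measurable borel"
  by (intro borel_measurable_continuous_onI continuous_on_measure_Int_ball assms continuous_intros)

lemma half_dense_borel:
  assumes "E \<in> sets borel"
  shows "half_dense E \<in> sets borel"
proof -
  note [measurable] = borel_measurable_measure_Int_ball[OF assms]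
    borel_measurable_measure_Int_ball[of "UNIV :: 'a set", simplified]
  show ?thesis
    unfolding half_dense_def frequently_sequentially by measurable
qed

lemma measure_Int_ball_mono:
  fixes x :: "'a::euclidean_space"
  assumes "E \<subseteq> F" "F \<in> sets borel"
  shows "measure lborel (E \<inter> ball x r) \<le> measure lborel (F \<inter> ball x r)"
proof (cases "E \<inter> ball x r \<in> sets lborel")
  case True
  show ?thesis
  proof (rule measure_mono_fmeasurable)
    have "F \<inter> ball x r \<in> sets lborel" using assms by simp
    then show "F \<inter> ball x r \<in> fmeasurable lborel"
      by (metis Int_commute assms(2) fmeasurable_Int_fmeasurable fmeasurable_ball sets_lborel)
  qed (use assms True in auto)
qed (simp add: measure_notin_sets)

lemma half_dense_mono:
  assumes "E \<subseteq> F" "F \<in> sets borel"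
  shows "half_dense E \<subseteq> half_dense F"
proof
  fix x assume "x \<in> half_dense E"
  then have "\<exists>\<^sub>F k in sequentially. measure lborel (ball x (1 / Suc k)) < 2 * measure lborel (E \<inter> ball x (1 / Suc k))"
    by (simp add: half_dense_def)
  then have "\<exists>\<^sub>F k in sequentially. measure lborel (ball x (1 / Suc k)) < 2 * measure lborel (F \<inter> ball x (1 / Suc k))"
  proof (rule frequently_elim1)
    fix k :: nat
    assume "measure lborel (ball x (1 / Suc k)) < 2 * measure lborel (E \<inter> ball x (1 / Suc k))"
    with measure_Int_ball_mono[OF assms, of x "1 / Suc k"]
    show "measure lborel (ball x (1 / Suc k)) < 2 * measure lborel (F \<inter> ball x (1 / Suc k))"
      by linarith
  qed
  then show "x \<in> half_dense F" by (simp add: half_dense_def)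
qed

text \<open>A weak form of the Lebesgue density theorem. It lets the level sums control the function
  itself almost everywhere, which the comparison of mean and median needs.\<close>

lemma AE_half_dense:
  assumes E: "E \<in> sets borel"
  shows "AE x in lborel. x \<in> E \<longrightarrow> x \<in> half_dense E"
proof -
  let ?r = "\<lambda>k::nat. 1 / real (Suc k)"
  \<comment> \<open>If a point of E is not in \<open>half_dense E\<close>, then from some index m on
    E fills at most half of every test ball. So the bad set is the countable union of the
    \<open>A m\<close>.\<close>
  define A where "A m = {x\<in>E. \<forall>k\<ge>m. 2 * measure lborel (E \<inter> ball x (?r k)) \<le> measure lborel (ball x (?r k))}" for m :: nat
  note [measurable] = borel_measurable_measure_Int_ball[OF E]
    borel_measurable_measure_Int_ball[of "UNIV :: 'a set", simplified]
  have A_borel [measurable]: "A m \<in> sets borel" for m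
    using E unfolding A_def by measurable
  have "emeasure lborel (A m) \<le> ennreal e" if "e > 0" for m and e :: real
  proof -
    \<comment> \<open>In each Vitali ball \<open>A m\<close> occupies at most half of the volume, so its measure is at most
      that of the rest of the ball, which lies in \<open>U - A m\<close>.\<close>
    obtain U where U: "open U" "A m \<subseteq> U" "emeasure lborel (U - A m) < e"
      by (rule outer_regular_lborel[OF A_borel[of m] \<open>e > 0\<close>])
    define K where "K = {(x, k). x \<in> A m \<and> k \<ge> m \<and> ball x (?r k) \<subseteq> U}"
    have "\<exists>i. i \<in> K \<and> x \<in> ball (fst i) (?r (snd i)) \<and> ?r (snd i) < d" if "x \<in> A m" "0 < d" for x d
    proof -
      obtain d' where d': "d' > 0" "ball x d' \<subseteq> U"
        using U(1,2) \<open>x \<in> A m\<close> open_contains_ball by blast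
      obtain k where k: "?r k < min d d'"
        using nat_approx_posE[of "min d d'"] \<open>0 < d\<close> \<open>0 < d'\<close> by (metis min_less_iff_conj)
      have "?r (max k m) \<le> ?r k" by (intro frac_le) auto
      with k have "?r (max k m) < min d d'" by linarith
      with d' that have "(x, max k m) \<in> K" "?r (max k m) < d"
        unfolding K_def by auto
      then show ?thesis by (intro exI[of _ "(x, max k m)"]) auto
    qed
    then obtain C where C: "countable C" "C \<subseteq> K"
      and dis: "pairwise (\<lambda>i j. disjnt (ball (fst i) (?r (snd i))) (ball (fst j) (?r (snd j)))) C"
      and neg: "negligible (A m - (\<Union>i\<in>C. ball (fst i) (?r (snd i))))"
      by (rule Vitali_covering_theorem_balls[where K = K and a = fst and r = "\<lambda>i. ?r (snd i)" and S = "A m"])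
    let ?B = "\<lambda>i :: 'a \<times> nat. ball (fst i) (?r (snd i))"
    have dis': "disjoint_family_on ?B C"
      using dis by (auto simp: disjoint_family_on_def pairwise_def disjnt_def)
    have subU: "?B i \<subseteq> U" if "i \<in> C" for i
    proof -
      have "i \<in> K" using that C by blast
      then show ?thesis by (simp add: K_def case_prod_beta)
    qed
    have le: "emeasure lborel (A m \<inter> ?B i) \<le> emeasure lborel (?B i - A m)" if "i \<in> C" for i
    proof -
      have fin: "A m \<inter> ?B i \<in> fmeasurable lborel" "?B i \<in> fmeasurable lborel"
        "?B i - A m \<in> fmeasurable lborel"
        using fmeasurable_Int_fmeasurable[of "?B i" lborel "A m"]
        by (auto simp: Int_commute intro: fmeasurable_Diff)
      have "measure lborel (A m \<inter> ?B i) \<le> measure lborel (E \<inter> ?B i)"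
        by (rule measure_Int_ball_mono) (use E in \<open>auto simp: A_def\<close>)
      moreover have "2 * measure lborel (E \<inter> ?B i) \<le> measure lborel (?B i)"
        using that C by (auto simp: K_def A_def)
      moreover have "measure lborel (?B i) = measure lborel (A m \<inter> ?B i) + measure lborel (?B i - A m)"
        using measure_Un2[OF fin(1,2)] by (simp add: Diff_Int Un_absorb1)
      ultimately have "measure lborel (A m \<inter> ?B i) \<le> measure lborel (?B i - A m)" by linarith
      then show ?thesis
        using fin by (simp add: emeasure_eq_measure2 ennreal_leI)
    qed
    have "emeasure lborel (A m) \<le> emeasure lborel ((\<Union>i\<in>C. A m \<inter> ?B i) \<union> (A m - (\<Union>i\<in>C. ?B i)))"
      using C by (intro emeasure_mono) (auto intro!: sets.Un sets.Diff sets.countable_UN' sets.Int)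
    also have "\<dots> = emeasure lborel (\<Union>i\<in>C. A m \<inter> ?B i)"
    proof (rule emeasure_Un_null_set)
      have "A m - (\<Union>i\<in>C. ?B i) \<in> sets lborel"
        using C by (intro sets.Diff sets.countable_UN') auto
      then show "A m - (\<Union>i\<in>C. ?B i) \<in> null_sets lborel"
        using neg by (simp only: negligible_iff_null_sets null_sets_completion_iff)
    qed (use C in \<open>auto intro!: sets.countable_UN'\<close>)
    also have "\<dots> = (\<integral>\<^sup>+i. emeasure lborel (A m \<inter> ?B i) \<partial>count_space C)"
      using C by (intro emeasure_UN_countable disjoint_family_on_bisimulation[OF dis']) auto
    also have "\<dots> \<le> (\<integral>\<^sup>+i. emeasure lborel (?B i - A m) \<partial>count_space C)"
      using le by (intro nn_integral_mono) auto
    also have "\<dots> = emeasure lborel (\<Union>i\<in>C. ?B i - A m)"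
      using C by (intro emeasure_UN_countable[symmetric] disjoint_family_on_bisimulation[OF dis']) auto
    also have "\<dots> \<le> emeasure lborel (U - A m)"
    proof (rule emeasure_mono)
      show "(\<Union>i\<in>C. ?B i - A m) \<subseteq> U - A m" using subU by blast
    qed (use U(1) in auto)
    finally show ?thesis using U(3) by simp
  qed
  then have "emeasure lborel (A m) = 0" for m
    by (metis ennreal_le_epsilon add_0 le_zero_eq)
  then have "AE x in lborel. x \<notin> A m" for m
    by (intro AE_not_in) auto
  then have "AE x in lborel. \<forall>m. x \<notin> A m"
    by (simp add: AE_all_countable)
  then show ?thesis
  proof eventually_elim
    case (elim x)
    show ?case
      using elim unfolding half_dense_def A_def frequently_sequentially
      by (auto simp: not_le)
  qed
qed

section \<open>The fractional Poincare inequality on convex sets\<close>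

lemma nn_integral_midpoint:
  fixes x :: "'a::euclidean_space"
  assumes [measurable]: "F \<in> borel_measurable borel"
  shows "(\<integral>\<^sup>+y. F (midpoint x y) \<partial>lborel) = ennreal (2 ^ DIM('a)) * (\<integral>\<^sup>+y. F y \<partial>lborel)"
proof -
  let ?g = "\<lambda>y. (1/2) *\<^sub>R x + (1/2) *\<^sub>R y"
  have eq: "midpoint x y = ?g y" for y
    by (simp add: midpoint_def scaleR_add_right)
  have "(\<integral>\<^sup>+y. F y \<partial>lborel) = (\<integral>\<^sup>+y. F y \<partial>density (distr lborel borel ?g) (\<lambda>_. ennreal (\<bar>1/2\<bar>^DIM('a))))"
    using lborel_affine[of "1/2" "(1/2) *\<^sub>R x"] by auto
  also have "\<dots> = ennreal ((1/2)^DIM('a)) * (\<integral>\<^sup>+y. F (midpoint x y) \<partial>lborel)"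
    unfolding eq by (simp add: nn_integral_density nn_integral_distr nn_integral_cmult)
  finally have "ennreal (2 ^ DIM('a)) * (\<integral>\<^sup>+y. F y \<partial>lborel)
      = ennreal (2 ^ DIM('a)) * ennreal ((1/2)^DIM('a)) * (\<integral>\<^sup>+y. F (midpoint x y) \<partial>lborel)"
    by (simp add: mult.assoc)
  also have "ennreal (2 ^ DIM('a)) * ennreal ((1/2)^DIM('a)) = 1"
    by (subst ennreal_mult[symmetric]) (simp_all add: power_mult_distrib[symmetric])
  finally show ?thesis by simp
qed

text \<open>A pair at distance at most d is compared through its midpoint, which gives two pairs at
  distance at most d/2. Symmetry and Fubini make both terms equal, and the change of variables to
  the midpoint costs 2^n; hence 2 * 2^n. \<open>tri\<close> is restricted to w > 0 so that w may
  carry the indicator of a convex set.\<close>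

lemma nn_integral_midpoint_halving:
  fixes w :: "'a::euclidean_space \<Rightarrow> 'a \<Rightarrow> ennreal"
  assumes [measurable]: "case_prod w \<in> borel_measurable (borel \<Otimes>\<^sub>M borel)"
    and sym: "\<And>x y. w x y = w y x"
    and tri: "\<And>x y. w x y > 0 \<Longrightarrow> w x y \<le> w x (midpoint x y) + w (midpoint x y) y"
  defines "J \<equiv> \<lambda>d. \<integral>\<^sup>+x. \<integral>\<^sup>+y. w x y * indicator {..d::real} (dist x y) \<partial>lborel \<partial>lborel"
  shows "J d \<le> ennreal (2 ^ (DIM('a) + 1)) * J (d / 2)"
proof -
  let ?v = "\<lambda>x y. w x y * indicator {..d / 2} (dist x y)"
  have [measurable]: "case_prod ?v \<in> borel_measurable (borel \<Otimes>\<^sub>M borel)" by measurable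
  have [measurable]: "(\<lambda>(x, y). midpoint x y :: 'a) \<in> borel \<Otimes>\<^sub>M borel \<rightarrow>\<^sub>M borel"
    unfolding midpoint_def by measurable
  have vsym: "?v x y = ?v y x" for x y
    by (simp add: sym[of x y] dist_commute)
  have pw: "w x y * indicator {..d} (dist x y) \<le> ?v x (midpoint x y) + ?v y (midpoint y x)" for x y
  proof (cases "w x y > 0 \<and> dist x y \<le> d")
    case True
    then have "dist x (midpoint x y) \<le> d / 2" "dist y (midpoint y x) \<le> d / 2"
      by (simp_all add: dist_midpoint dist_commute)
    then show ?thesis
      using True tri[of x y] by (simp add: midpoint_sym[of y x] sym[of y])
  qed (auto simp: not_less)
  have mid: "(\<integral>\<^sup>+y. ?v x (midpoint x y) \<partial>lborel) = ennreal (2 ^ DIM('a)) * (\<integral>\<^sup>+y. ?v x y \<partial>lborel)" for x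
    by (rule nn_integral_midpoint[of "?v x"]) measurable
  have half: "(\<integral>\<^sup>+x. \<integral>\<^sup>+y. ?v x (midpoint x y) \<partial>lborel \<partial>lborel) = ennreal (2 ^ DIM('a)) * J (d / 2)"
    unfolding mid J_def by (rule nn_integral_cmult) measurable
  have "J d \<le> (\<integral>\<^sup>+x. \<integral>\<^sup>+y. ?v x (midpoint x y) + ?v y (midpoint y x) \<partial>lborel \<partial>lborel)"
    unfolding J_def by (intro nn_integral_mono pw)
  also have "\<dots> = (\<integral>\<^sup>+x. (\<integral>\<^sup>+y. ?v x (midpoint x y) \<partial>lborel) + (\<integral>\<^sup>+y. ?v y (midpoint y x) \<partial>lborel) \<partial>lborel)"
    by (intro nn_integral_cong nn_integral_add) measurable
  also have "\<dots> = (\<integral>\<^sup>+x. \<integral>\<^sup>+y. ?v x (midpoint x y) \<partial>lborel \<partial>lborel)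
       + (\<integral>\<^sup>+x. \<integral>\<^sup>+y. ?v y (midpoint y x) \<partial>lborel \<partial>lborel)"
    by (rule nn_integral_add) measurable
  also have "(\<integral>\<^sup>+x. \<integral>\<^sup>+y. ?v y (midpoint y x) \<partial>lborel \<partial>lborel)
     = (\<integral>\<^sup>+y. \<integral>\<^sup>+x. ?v y (midpoint y x) \<partial>lborel \<partial>lborel)"
    by (rule lborel_pair.Fubini') measurable
  finally have "J d \<le> ennreal (2 ^ DIM('a)) * J (d / 2) + ennreal (2 ^ DIM('a)) * J (d / 2)"
    unfolding half .
  also have "\<dots> = ennreal (2 ^ DIM('a) + 2 ^ DIM('a)) * J (d / 2)"
    by (subst ennreal_plus) (auto simp only: distrib_right zero_le_power zero_le_numeral)
  finally show ?thesis by (simp only: mult_2[symmetric] power_add power_one_right mult.commute)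
qed

text \<open>Since p >= 1 the weights at least double with k, so their sum up to the last k with t <=
  d/2^k is at most twice the last one, and there 2^k/d <= 1/t.\<close>

lemma geometric_le_powr:
  fixes t d p :: real
  assumes "1 \<le> p" "0 < t" "0 < d"
  shows "(\<Sum>k. ennreal ((2 ^ k / d) powr p) * indicator {..d / 2 ^ k} t) \<le> ennreal (2 / t powr p)"
proof (rule suminf_le_const[OF summableI])
  fix m
  have step: "2 * (2 ^ k / d) powr p \<le> (2 ^ Suc k / d) powr p" for k
  proof -
    have "(2::real) powr 1 \<le> 2 powr p" using assms by (intro powr_mono) auto
    then have "2 * (2 ^ k / d) powr p \<le> 2 powr p * (2 ^ k / d) powr p"
      by (intro mult_right_mono) auto
    also have "\<dots> = (2 * (2 ^ k / d)) powr p"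
      by (rule powr_mult[symmetric])
    finally show ?thesis by simp
  qed
  have geo: "(\<Sum>k<j. (2 ^ k / d) powr p) \<le> (2 ^ j / d) powr p" for j
  proof (induction j)
    case (Suc j)
    then show ?case using step[of j] by simp
  qed simp
  have "(\<Sum>k<m. (2 ^ k / d) powr p * indicator {..d / 2 ^ k} t) \<le> 2 / t powr p"
  proof (induction m)
    case 0
    then show ?case by simp
  next
    case (Suc m)
    show ?case
    proof (cases "t \<le> d / 2 ^ m")
      case True
      have "(\<Sum>k<Suc m. (2 ^ k / d) powr p * indicator {..d / 2 ^ k} t)
          \<le> (\<Sum>k<Suc m. (2 ^ k / d) powr p)"
        by (intro sum_mono) (auto simp: indicator_def)
      also have "\<dots> \<le> 2 * (2 ^ m / d) powr p" using geo[of m] by simp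
      also have "2 ^ m / d \<le> 1 / t" using True assms by (simp add: field_simps)
      then have "(2 ^ m / d) powr p \<le> (1 / t) powr p"
        using assms by (intro powr_mono2) auto
      also have "(1 / t) powr p = 1 / t powr p" using assms by (subst powr_divide) auto
      finally show ?thesis by simp
    qed (use Suc in simp)
  qed
  then have "ennreal (\<Sum>k<m. (2 ^ k / d) powr p * indicator {..d / 2 ^ k} t) \<le> ennreal (2 / t powr p)"
    by (rule ennreal_leI)
  also have "ennreal (\<Sum>k<m. (2 ^ k / d) powr p * indicator {..d / 2 ^ k} t)
      = (\<Sum>k<m. ennreal ((2 ^ k / d) powr p * indicator {..d / 2 ^ k} t))"
    by (rule sum_ennreal[symmetric]) simp
  also have "\<dots> = (\<Sum>k<m. ennreal ((2 ^ k / d) powr p) * indicator {..d / 2 ^ k} t)"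
    by (rule sum.cong) (simp_all add: indicator_def)
  finally show "(\<Sum>k<m. ennreal ((2 ^ k / d) powr p) * indicator {..d / 2 ^ k} t) \<le> ennreal (2 / t powr p)" .
qed

text \<open>Source of the factor 1 - delta: the geometric series with ratio 2^(delta-1) sums to at
  least 1/(1 - delta).\<close>

lemma one_minus_two_powr_le:
  fixes \<delta> :: real
  assumes "\<delta> < 1"
  shows "1 - 2 powr (\<delta> - 1) \<le> 1 - \<delta>"
proof -
  have "1 + (\<delta> - 1) \<le> 1 + (\<delta> - 1) * ln 2"
    using mult_left_mono_neg[of "ln 2" 1 "\<delta> - 1"] assms ln_2_less_1 by (simp add: algebra_simps)
  also have "\<dots> \<le> exp ((\<delta> - 1) * ln 2)" by (rule exp_ge_add_one_self)
  also have "\<dots> = 2 powr (\<delta> - 1)" by (simp add: powr_def)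
  finally show ?thesis by simp
qed

text \<open>The bounds obtained after k halvings are added with weights d^(-p) 2^(k(delta-1)), where
  p = n + delta. The left side becomes a geometric series; on the right the weights turn into
  (2^k/d)^p, whose sum over the k with |x-y| <= d/2^k is at most twice the kernel.\<close>

theorem fractional_Poincare_convex:
  fixes f :: "'a::euclidean_space \<Rightarrow> real" and \<delta> d :: real
  assumes [measurable]: "f \<in> borel_measurable borel" "K \<in> sets borel"
    and K: "convex K" "\<And>x y. x \<in> K \<Longrightarrow> y \<in> K \<Longrightarrow> dist x y \<le> d" and d: "0 < d"
    and \<delta>: "0 < \<delta>" "\<delta> < 1"
  shows "(\<integral>\<^sup>+x\<in>K. \<integral>\<^sup>+y\<in>K. ennreal \<bar>f x - f y\<bar> \<partial>lborel \<partial>lborel) \<le> ennreal (2 * d powr (DIM('a) + \<delta>) * (1 - \<delta>)) *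
    (\<integral>\<^sup>+x\<in>K. \<integral>\<^sup>+y\<in>K. ennreal (\<bar>f x - f y\<bar> / dist x y powr (DIM('a) + \<delta>)) \<partial>lborel \<partial>lborel)"
proof -
  define w where "w = (\<lambda>x y. indicator K x * indicator K y * ennreal \<bar>f x - f y\<bar>)"
  let ?n = "DIM('a)" and ?p = "real DIM('a) + \<delta>" and ?x = "2 powr (\<delta> - 1)"
  define J where "J = (\<lambda>\<rho>::real. \<integral>\<^sup>+x. \<integral>\<^sup>+y. w x y * indicator {..\<rho>} (dist x y) \<partial>lborel \<partial>lborel)"
  define W where "W = (\<integral>\<^sup>+x. \<integral>\<^sup>+y. w x y \<partial>lborel \<partial>lborel)"
  define I where "I = (\<integral>\<^sup>+x. \<integral>\<^sup>+y. w x y * ennreal (1 / dist x y powr ?p) \<partial>lborel \<partial>lborel)"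
  have [measurable]: "case_prod w \<in> borel_measurable (borel \<Otimes>\<^sub>M borel)"
    unfolding w_def by measurable
  have halving: "J \<rho> \<le> ennreal (2 ^ (?n + 1)) * J (\<rho> / 2)" for \<rho>
    unfolding J_def
  proof (rule nn_integral_midpoint_halving)
    show "w x y = w y x" for x y
      by (simp add: w_def abs_minus_commute mult.commute)
    show "w x y \<le> w x (midpoint x y) + w (midpoint x y) y" if "w x y > 0" for x y
    proof -
      have "x \<in> K" "y \<in> K" using that by (auto simp: w_def zero_less_iff_neq_zero split: split_indicator_asm)
      moreover from this have "midpoint x y \<in> K"
        using K(1) convexD[of K x y "1/2" "1/2"] by (simp add: midpoint_def scaleR_add_right)
      ultimately show ?thesis
        by (simp add: w_def ennreal_plus[symmetric] del: ennreal_plus)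
    qed
  qed measurable
  have "W = J d"
    unfolding W_def J_def
    by (intro nn_integral_cong) (use K(2) in \<open>auto simp: w_def indicator_def\<close>)
  have iter: "W \<le> ennreal (2 ^ ((?n + 1) * k)) * J (d / 2 ^ k)" for k
  proof (induction k)
    case (Suc k)
    note Suc
    also have "ennreal (2 ^ ((?n + 1) * k)) * J (d / 2 ^ k)
        \<le> ennreal (2 ^ ((?n + 1) * k)) * (ennreal (2 ^ (?n + 1)) * J (d / 2 ^ k / 2))"
      by (intro mult_left_mono halving) simp
    also have "\<dots> = ennreal (2 ^ ((?n + 1) * k) * 2 ^ (?n + 1)) * J (d / 2 ^ Suc k)"
      by (subst ennreal_mult) (simp_all add: mult_ac)
    also have "(2::real) ^ ((?n + 1) * k) * 2 ^ (?n + 1) = 2 ^ ((?n + 1) * Suc k)"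
      by (simp only: power_add[symmetric] mult_Suc_right add.commute)
    finally show ?case .
  qed (simp add: \<open>W = J d\<close>)
  \<comment> \<open>Writing p = (n+1) + (delta-1) splits the weight into the loss of k halvings and
    a term of the geometric series.\<close>
  have c: "(2 ^ k / d) powr ?p = 2 ^ ((?n + 1) * k) * (d powr - ?p * ?x ^ k)" for k
  proof -
    have "(2 ^ k / d) powr ?p = (2 ^ k) powr ?p * d powr - ?p"
      using d unfolding powr_minus_divide by (subst powr_divide) auto
    also have "(2 ^ k) powr ?p = 2 powr (real ((?n + 1) * k) + (\<delta> - 1) * real k)"
      by (simp add: powr_realpow[symmetric] powr_powr algebra_simps)
    also have "\<dots> = 2 ^ ((?n + 1) * k) * ?x ^ k"
      by (simp only: powr_add powr_realpow[OF zero_less_numeral] powr_powr[symmetric])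
         (simp add: powr_realpow)
    finally show ?thesis by simp
  qed
  have x1: "0 < ?x" "?x < 1" using \<delta> powr_less_mono[of "\<delta> - 1" 0 "2::real"] by simp_all
  have "ennreal (d powr - ?p * (1 / (1 - ?x))) * W = (\<Sum>k. ennreal (d powr - ?p * ?x ^ k)) * W"
  proof -
    have "(\<lambda>k. d powr - ?p * ?x ^ k) sums (d powr - ?p * (1 / (1 - ?x)))"
      by (intro sums_mult geometric_sums) (use x1 in simp)
    from suminf_ennreal_eq[OF _ this] show ?thesis by (simp only: zero_le_mult_iff powr_ge_zero zero_le_power simp_thms)
  qed
  also have "\<dots> = (\<Sum>k. ennreal (d powr - ?p * ?x ^ k) * W)"
    by (rule ennreal_suminf_multc[symmetric])
  also have "\<dots> \<le> (\<Sum>k. ennreal ((2 ^ k / d) powr ?p) * J (d / 2 ^ k))"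
  proof (intro suminf_le summableI)
    fix k
    have "ennreal (d powr - ?p * ?x ^ k) * W
        \<le> ennreal (d powr - ?p * ?x ^ k) * (ennreal (2 ^ ((?n + 1) * k)) * J (d / 2 ^ k))"
      by (intro mult_left_mono iter) simp
    also have "\<dots> = ennreal ((2 ^ k / d) powr ?p) * J (d / 2 ^ k)"
      unfolding c by (subst ennreal_mult) (simp_all add: mult_ac)
    finally show "ennreal (d powr - ?p * ?x ^ k) * W \<le> ennreal ((2 ^ k / d) powr ?p) * J (d / 2 ^ k)" .
  qed
  also have "\<dots> = (\<Sum>k. \<integral>\<^sup>+x. \<integral>\<^sup>+y. ennreal ((2 ^ k / d) powr ?p) * (w x y * indicator {..d / 2 ^ k} (dist x y)) \<partial>lborel \<partial>lborel)"
    unfolding J_def by ((subst nn_integral_cmult, measurable)+)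
  also have "\<dots> = (\<integral>\<^sup>+x. (\<Sum>k. \<integral>\<^sup>+y. ennreal ((2 ^ k / d) powr ?p) * (w x y * indicator {..d / 2 ^ k} (dist x y)) \<partial>lborel) \<partial>lborel)"
    by (rule nn_integral_suminf[symmetric]) measurable
  also have "\<dots> = (\<integral>\<^sup>+x. \<integral>\<^sup>+y. (\<Sum>k. ennreal ((2 ^ k / d) powr ?p) * (w x y * indicator {..d / 2 ^ k} (dist x y))) \<partial>lborel \<partial>lborel)"
    by (intro nn_integral_cong nn_integral_suminf[symmetric]) measurable
  also have "\<dots> \<le> (\<integral>\<^sup>+x. \<integral>\<^sup>+y. ennreal 2 * (w x y * ennreal (1 / dist x y powr ?p)) \<partial>lborel \<partial>lborel)"
  proof (intro nn_integral_mono)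
    fix x y
    show "(\<Sum>k. ennreal ((2 ^ k / d) powr ?p) * (w x y * indicator {..d / 2 ^ k} (dist x y)))
        \<le> ennreal 2 * (w x y * ennreal (1 / dist x y powr ?p))"
    \<comment> \<open>On the diagonal the weights sum to infinity while the kernel is
      \<open>1 / 0 = 0\<close>; both sides vanish because \<open>w x x = 0\<close>.\<close>
    proof (cases "x = y")
      case False
      have "(\<Sum>k. ennreal ((2 ^ k / d) powr ?p) * (w x y * indicator {..d / 2 ^ k} (dist x y)))
          = w x y * (\<Sum>k. ennreal ((2 ^ k / d) powr ?p) * indicator {..d / 2 ^ k} (dist x y))"
        by (simp add: mult_ac flip: ennreal_suminf_cmult)
      also have "\<dots> \<le> w x y * ennreal (2 / dist x y powr ?p)"
        using False d \<delta> by (intro mult_left_mono geometric_le_powr) (auto simp: Suc_leI DIM_positive intro: add_increasing2)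
      also have "ennreal (2 / dist x y powr ?p) = ennreal 2 * ennreal (1 / dist x y powr ?p)"
        by (subst ennreal_mult[symmetric]) auto
      finally show ?thesis by (simp add: mult_ac)
    qed (simp add: w_def)
  qed
  also have "\<dots> = ennreal 2 * I"
    unfolding I_def by ((subst nn_integral_cmult, measurable)+)
  finally have main: "ennreal (d powr - ?p * (1 / (1 - ?x))) * W \<le> ennreal 2 * I" .
  have "1 \<le> (1 - \<delta>) / (1 - ?x)"
    using one_minus_two_powr_le[OF \<delta>(2)] x1 by simp
  also have "\<dots> = d powr ?p * d powr - ?p * ((1 - \<delta>) / (1 - ?x))"
    using d unfolding powr_add[symmetric] by simp
  also have "\<dots> = d powr ?p * (1 - \<delta>) * (d powr - ?p * (1 / (1 - ?x)))"
    by simp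
  finally have "ennreal 1 * W \<le> ennreal (d powr ?p * (1 - \<delta>) * (d powr - ?p * (1 / (1 - ?x)))) * W"
    by (intro mult_right_mono ennreal_leI) auto
  also have "\<dots> = ennreal (d powr ?p * (1 - \<delta>)) * (ennreal (d powr - ?p * (1 / (1 - ?x))) * W)"
    using \<delta> x1 by (subst ennreal_mult) (auto simp: mult.assoc)
  also have "\<dots> \<le> ennreal (d powr ?p * (1 - \<delta>)) * (ennreal 2 * I)"
    by (intro mult_left_mono main) simp
  also have "\<dots> = ennreal (2 * d powr ?p * (1 - \<delta>)) * I"
    using \<delta> by (subst mult.assoc[symmetric], subst ennreal_mult[symmetric]) (auto simp: mult_ac)
  finally have "W \<le> ennreal (2 * d powr ?p * (1 - \<delta>)) * I" by simp
  moreover have "W = (\<integral>\<^sup>+x\<in>K. \<integral>\<^sup>+y\<in>K. ennreal \<bar>f x - f y\<bar> \<partial>lborel \<partial>lborel)"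
    unfolding W_def
  proof (intro nn_integral_cong)
    fix x
    have "w x y = ennreal \<bar>f x - f y\<bar> * indicator K y * indicator K x" for y
      by (simp add: w_def mult_ac)
    then show "(\<integral>\<^sup>+y. w x y \<partial>lborel) = (\<integral>\<^sup>+y\<in>K. ennreal \<bar>f x - f y\<bar> \<partial>lborel) * indicator K x"
      by (simp only:) (rule nn_integral_multc, measurable)
  qed
  moreover have "I = (\<integral>\<^sup>+x\<in>K. \<integral>\<^sup>+y\<in>K. ennreal (\<bar>f x - f y\<bar> / dist x y powr ?p) \<partial>lborel \<partial>lborel)"
    unfolding I_def
  proof (intro nn_integral_cong)
    fix x
    have "w x y * ennreal (1 / dist x y powr ?p) = ennreal (\<bar>f x - f y\<bar> / dist x y powr ?p) * indicator K y * indicator K x" for y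
      by (simp add: w_def ennreal_mult[symmetric] split: split_indicator)
    then show "(\<integral>\<^sup>+y. w x y * ennreal (1 / dist x y powr ?p) \<partial>lborel)
        = (\<integral>\<^sup>+y\<in>K. ennreal (\<bar>f x - f y\<bar> / dist x y powr ?p) \<partial>lborel) * indicator K x"
      by (simp only:) (rule nn_integral_multc, measurable)
  qed
  ultimately show ?thesis by simp
qed

text \<open>Pairs with x in the part of the ball inside E and y in the part outside have oscillation
  1, and at density one half they fill a quarter of the product of the ball with itself. The
  Poincare inequality on the ball, with diameter bound 2r, compares this with the energy.\<close>

lemma relative_fractional_isoperimetric_ball:
  fixes E :: "'a::euclidean_space set" and \<delta> r :: real
  assumes [measurable]: "E \<in> sets borel" and r: "0 < r" and \<delta>: "0 < \<delta>" "\<delta> < 1"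
    and half: "2 * measure lborel (E \<inter> ball z r) = measure lborel (ball z r)"
  shows "ennreal ((unit_ball_vol DIM('a))\<^sup>2 * r powr (DIM('a) - \<delta>)) \<le> ennreal (2 ^ (DIM('a) + 4) * (1 - \<delta>)) *
    (\<integral>\<^sup>+x\<in>ball z r. \<integral>\<^sup>+y\<in>ball z r. ennreal (\<bar>indicat_real E x - indicat_real E y\<bar> / dist x y powr (DIM('a) + \<delta>)) \<partial>lborel \<partial>lborel)"
proof -
  let ?B = "ball z r" and ?n = "real DIM('a)" and ?v = "unit_ball_vol (real DIM('a))"
  define I where "I = (\<integral>\<^sup>+x\<in>ball z r. \<integral>\<^sup>+y\<in>ball z r. ennreal (\<bar>indicat_real E x - indicat_real E y\<bar> / dist x y powr (?n + \<delta>)) \<partial>lborel \<partial>lborel)"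
  have vol: "measure lborel ?B = ?v * r ^ DIM('a)"
    using r by (simp add: content_ball)
  have EB: "measure lborel (E \<inter> ?B) = ?v * r ^ DIM('a) / 2" using half vol by simp
  have fm: "E \<inter> ?B \<in> fmeasurable lborel" "?B - E \<in> fmeasurable lborel"
    using fmeasurable_Int_fmeasurable[of ?B lborel E] by (auto simp: Int_commute intro: fmeasurable_Diff)
  have "measure lborel ?B = measure lborel (E \<inter> ?B) + measure lborel (?B - E)"
    using measure_Un2[OF fm(1) fmeasurable_ball[of z r]] by (simp add: Diff_Int Un_absorb1)
  then have BE: "measure lborel (?B - E) = ?v * r ^ DIM('a) / 2" using vol EB by simp
  have "ennreal ((?v * r ^ DIM('a) / 2)\<^sup>2) = emeasure lborel (E \<inter> ?B) * emeasure lborel (?B - E)"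
    using r by (simp add: emeasure_eq_measure2[OF fm(1)] emeasure_eq_measure2[OF fm(2)] EB BE ennreal_mult[symmetric] power2_eq_square)
  also have "\<dots> = (\<integral>\<^sup>+x. \<integral>\<^sup>+y. indicator (E \<inter> ?B) x * indicator (?B - E) y \<partial>lborel \<partial>lborel)"
    using fm by (simp add: nn_integral_cmult_indicator nn_integral_multc fmeasurableD)
  also have "\<dots> \<le> (\<integral>\<^sup>+x\<in>?B. \<integral>\<^sup>+y\<in>?B. ennreal \<bar>indicat_real E x - indicat_real E y\<bar> \<partial>lborel \<partial>lborel)"
  proof (rule nn_integral_mono)
    fix x
    show "(\<integral>\<^sup>+y. indicator (E \<inter> ?B) x * indicator (?B - E) y \<partial>lborel)
        \<le> (\<integral>\<^sup>+y\<in>?B. ennreal \<bar>indicat_real E x - indicat_real E y\<bar> \<partial>lborel) * indicator ?B x"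
    proof (cases "x \<in> E \<inter> ?B")
      case True
      then have "indicator ?B x = (1 :: ennreal)" by simp
      then show ?thesis
        by (simp only: mult_1_right) (intro nn_integral_mono, use True in \<open>auto split: split_indicator\<close>)
    qed simp
  qed
  also have "\<dots> \<le> ennreal (2 * (2 * r) powr (?n + \<delta>) * (1 - \<delta>)) * I"
    unfolding I_def
  proof (rule fractional_Poincare_convex)
    show "indicat_real E \<in> borel_measurable borel" by (intro borel_measurable_indicator) measurable
    fix x y assume "x \<in> ?B" "y \<in> ?B"
    then show "dist x y \<le> 2 * r" using dist_triangle_less_add[of x z r y r] by (simp add: dist_commute)
  qed (use r \<delta> in auto)
  finally have *: "ennreal ((?v * r ^ DIM('a) / 2)\<^sup>2) \<le> ennreal (2 * (2 * r) powr (?n + \<delta>) * (1 - \<delta>)) * I" .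
  have "ennreal (?v\<^sup>2 * r powr (?n - \<delta>)) = ennreal (4 * r powr - (?n + \<delta>)) * ennreal ((?v * r ^ DIM('a) / 2)\<^sup>2)"
  proof -
    have "r powr (?n - \<delta>) = r powr (?n + ?n + - (?n + \<delta>))" by simp
    also have "\<dots> = (r ^ DIM('a))\<^sup>2 * r powr - (?n + \<delta>)"
      using r by (simp only: powr_add) (simp add: powr_realpow power2_eq_square)
    finally show ?thesis
      by (subst ennreal_mult[symmetric]) (simp_all add: power_mult_distrib power_divide mult_ac)
  qed
  also have "\<dots> \<le> ennreal (4 * r powr - (?n + \<delta>)) * (ennreal (2 * (2 * r) powr (?n + \<delta>) * (1 - \<delta>)) * I)"
    by (intro mult_left_mono *) simp
  also have "\<dots> = ennreal (8 * 2 powr (?n + \<delta>) * (1 - \<delta>)) * I"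
  proof -
    have "4 * r powr - p * (2 * (2 * r) powr p * (1 - \<delta>)) = 8 * 2 powr p * (1 - \<delta>)" for p
      using r by (simp add: powr_mult powr_minus)
    moreover have "ennreal (4 * r powr - p) * (ennreal (2 * (2 * r) powr p * (1 - \<delta>)) * I)
        = ennreal (4 * r powr - p * (2 * (2 * r) powr p * (1 - \<delta>))) * I" for p
      using \<delta> by (subst (3) ennreal_mult) (auto simp only: mult.assoc zero_le_mult_iff powr_ge_zero zero_le_numeral diff_ge_0_iff_ge less_imp_le)
    ultimately show ?thesis by (simp only:)
  qed
  also have "\<dots> \<le> ennreal (2 ^ (DIM('a) + 4) * (1 - \<delta>)) * I"
  proof -
    \<comment> \<open>Replacing delta by 1 in the exponent keeps the constant free of delta.\<close>
    have "8 * 2 powr (?n + \<delta>) \<le> 8 * 2 powr (?n + 1)"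
      using \<delta> by (intro mult_left_mono powr_mono) auto
    also have "\<dots> = 2 ^ (DIM('a) + 4)"
      by (simp add: powr_add powr_realpow power_add)
    finally show ?thesis
      using \<delta> by (intro mult_right_mono ennreal_leI) auto
  qed
  finally show ?thesis unfolding I_def .
qed

section \<open>Boxing inequality on John domains\<close>

text \<open>On the diagonal the kernel is \<open>1 / 0 = 0\<close>; it only ever occurs multiplied by a difference
  that vanishes there.\<close>

definition John_kernel :: "real \<Rightarrow> real \<Rightarrow> 'a::euclidean_space set \<Rightarrow> 'a \<Rightarrow> 'a \<Rightarrow> ennreal" where
  "John_kernel \<tau> \<delta> \<Omega> x y =
    (if x \<in> \<Omega> \<and> y \<in> \<Omega> \<and> norm (x - y) < \<tau> * bdist \<Omega> y then ennreal (1 / norm (x - y) powr (real DIM('a) + \<delta>)) else 0)"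

definition John_energy :: "real \<Rightarrow> real \<Rightarrow> 'a::euclidean_space set \<Rightarrow> ('a \<Rightarrow> real) \<Rightarrow> ennreal" where
  "John_energy \<tau> \<delta> \<Omega> h = (\<integral>\<^sup>+y. \<integral>\<^sup>+x. John_kernel \<tau> \<delta> \<Omega> x y * ennreal \<bar>h x - h y\<bar> \<partial>lborel \<partial>lborel)"

lemma continuous_on_bdist [continuous_intros]:
  "continuous_on S f \<Longrightarrow> continuous_on S (\<lambda>t. bdist \<Omega> (f t))"
  unfolding bdist_def by (intro continuous_intros)

lemma borel_measurable_bdist [measurable]: "bdist \<Omega> \<in> borel_measurable borel"
  by (intro borel_measurable_continuous_onI continuous_on_bdist continuous_intros)

lemma borel_measurable_John_kernel:
  fixes \<Omega> :: "'a::euclidean_space set"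
  assumes [measurable]: "\<Omega> \<in> sets borel"
  shows "(\<lambda>(x, y). John_kernel \<tau> \<delta> \<Omega> x y) \<in> borel_measurable (borel \<Otimes>\<^sub>M borel)"
  unfolding John_kernel_def by measurable

text \<open>\<open>D\<close> is a separate parameter so that the constants defined below mention
  only s, C_J, D, tau and the dimension; outside the locale they can be named before Omega and delta
  are chosen. \<open>s_le\<close> is s <= n/(n - delta) with the denominator cleared; it bounds
  powers with exponent s(n - delta) by n-th powers, free of delta.\<close>

locale John_domain =
  fixes \<Omega> :: "'a::euclidean_space set" and x\<^sub>J :: 'a and s C\<^sub>J D \<tau> \<delta> :: real
  assumes John: "distance_John_domain s C\<^sub>J x\<^sub>J \<Omega>"
    and diam: "diameter \<Omega> = D"
    and \<tau>: "0 < \<tau>" "\<tau> < 1"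
    and \<delta>: "0 < \<delta>" "\<delta> < 1"
    and s_le: "s * (DIM('a) - \<delta>) \<le> DIM('a)"
begin

lemma s_ge_1: "1 \<le> s" and C\<^sub>J_ge_1: "1 \<le> C\<^sub>J" and open_\<Omega>: "open \<Omega>" and bounded_\<Omega>: "bounded \<Omega>"
  and center: "x\<^sub>J \<in> \<Omega>"
  using John unfolding distance_John_domain_def by auto

lemma \<Omega>_borel [measurable]: "\<Omega> \<in> sets borel"
  using open_\<Omega> by simp

abbreviation "d \<equiv> bdist \<Omega>"

text \<open>\<open>infdist\<close> to the empty set is 0 by convention, so positivity of
  \<open>d\<close> depends on the existence of a boundary point.\<close>

lemma frontier_nonempty: "frontier \<Omega> \<noteq> {}"
proof
  assume "frontier \<Omega> = {}"
  then have "\<Omega> = UNIV" using frontier_eq_empty[of \<Omega>] center by auto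
  then show False using bounded_\<Omega> not_bounded_UNIV by auto
qed

text \<open>A ball is connected, so if it met both Omega and its complement it would contain a
  boundary point closer to x than \<open>d x\<close>.\<close>

lemma ball_bdist_subset:
  assumes "x \<in> \<Omega>"
  shows "ball x (d x) \<subseteq> \<Omega>"
proof (rule ccontr)
  assume "\<not> ball x (d x) \<subseteq> \<Omega>"
  then have "ball x (d x) \<inter> \<Omega> \<noteq> {}" "ball x (d x) - \<Omega> \<noteq> {}"
    using assms by (auto simp: ball_eq_empty)
       (metis centre_in_ball disjoint_iff infdist_nonneg bdist_def less_eq_real_def ball_empty empty_iff order_refl mem_ball)
  then obtain y where "y \<in> ball x (d x)" "y \<in> frontier \<Omega>"
    using connected_Int_frontier[of "ball x (d x)" \<Omega>] by auto
  then show False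
    using infdist_le[of y "frontier \<Omega>" x] by (simp add: bdist_def)
qed

lemma bdist_pos: "x \<in> \<Omega> \<Longrightarrow> 0 < d x"
proof -
  assume x: "x \<in> \<Omega>"
  have "x \<notin> frontier \<Omega>" using x open_\<Omega> by (simp add: frontier_def interior_open)
  then show ?thesis
    unfolding bdist_def using frontier_nonempty
    by (metis frontier_closed in_closed_iff_infdist_zero infdist_nonneg less_eq_real_def)
qed

lemma dist_le_D: "x \<in> \<Omega> \<Longrightarrow> y \<in> \<Omega> \<Longrightarrow> dist x y \<le> D"
  using diameter_bounded_bound[OF bounded_\<Omega>] diam by auto

lemma bdist_le_D:
  assumes "x \<in> \<Omega>"
  shows "d x \<le> D"
proof -
  have "diameter (ball x (d x)) \<le> diameter \<Omega>"
    by (rule diameter_subset[OF ball_bdist_subset bounded_\<Omega>]) fact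
  then show ?thesis using bdist_pos[OF assms] diam by simp
qed

lemma D_pos: "0 < D"
  using bdist_le_D[OF center] bdist_pos[OF center] by simp

lemma bdist_Lipschitz: "d x \<le> d y + dist x y"
  unfolding bdist_def by (rule infdist_triangle)

abbreviation "B\<^sub>J \<equiv> ball x\<^sub>J (\<tau> / 4 * d x\<^sub>J)"

lemma exists_half_ball:
  assumes E: "E \<in> sets borel" and x: "x \<in> \<Omega>" "x \<in> half_dense E"
    and B\<^sub>J: "2 * measure lborel (E \<inter> B\<^sub>J) \<le> measure lborel B\<^sub>J"
  obtains z r where "z \<in> \<Omega>" "0 < r" "r \<le> \<tau> / 4 * d z" "norm (z - x) powr s \<le> 4 * C\<^sub>J / \<tau> * r"
    "2 * measure lborel (E \<inter> ball z r) = measure lborel (ball z r)"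
proof -
  define \<phi> where "\<phi> z r = 2 * measure lborel (E \<inter> ball z r) - measure lborel (ball z r)" for z r
  have \<phi>: "continuous_on S (\<lambda>t. \<phi> (a t) (b t))" if "continuous_on S a" "continuous_on S b"
    for S :: "real set" and a b
    unfolding \<phi>_def
    using continuous_on_measure_Int_ball[OF E that] continuous_on_measure_Int_ball[of UNIV, OF _ that]
    by (intro continuous_intros) auto
  let ?R = "\<tau> / 4 * d x"
  have R: "0 < ?R" using \<tau> bdist_pos[OF x(1)] by simp
  show ?thesis
  \<comment> \<open>If E fills at least half of the ball of radius tau d(x)/4 at x, the center moves
    along the John curve until the density has dropped to one half, at the latest at the John
    center. Otherwise the center stays at x and only the radius varies, from a small one supplied by
    \<open>half_dense\<close>.\<close>
  proof (cases "\<phi> x ?R \<ge> 0")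
    case True
    obtain \<gamma> where \<gamma>: "rectifiable \<gamma>" "path_image \<gamma> \<subseteq> \<Omega>" "pathstart \<gamma> = x" "pathfinish \<gamma> = x\<^sub>J"
      and d\<gamma>: "\<And>t. t \<in> {0..1} \<Longrightarrow> C\<^sub>J * d (\<gamma> t) > norm (\<gamma> t - x) powr s"
      using John x(1) unfolding distance_John_domain_def by meson
    have c\<gamma>: "continuous_on {0..1} \<gamma>" using \<gamma>(1) by (simp add: rectifiable_def path_def)
    have "\<exists>t\<ge>0. t \<le> 1 \<and> \<phi> (\<gamma> t) (\<tau> / 4 * d (\<gamma> t)) = 0"
    proof (rule IVT2')
      show "\<phi> (\<gamma> 1) (\<tau> / 4 * d (\<gamma> 1)) \<le> 0"
        using \<gamma>(4) B\<^sub>J by (simp add: pathfinish_def \<phi>_def)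
      show "0 \<le> \<phi> (\<gamma> 0) (\<tau> / 4 * d (\<gamma> 0))"
        using \<gamma>(3) True by (simp add: pathstart_def)
    qed (auto intro!: \<phi> continuous_intros c\<gamma>)
    then obtain t where t: "t \<in> {0..1}" and t0: "\<phi> (\<gamma> t) (\<tau> / 4 * d (\<gamma> t)) = 0" by auto
    have \<gamma>t: "\<gamma> t \<in> \<Omega>" using \<gamma>(2) t by (auto simp: path_image_def)
    show ?thesis
    proof (rule that[OF \<gamma>t])
      show "0 < \<tau> / 4 * d (\<gamma> t)" using bdist_pos[OF \<gamma>t] \<tau> by simp
      show "norm (\<gamma> t - x) powr s \<le> 4 * C\<^sub>J / \<tau> * (\<tau> / 4 * d (\<gamma> t))"
        using d\<gamma>[OF t] \<tau> by simp
    qed (use t0 in \<open>auto simp: \<phi>_def\<close>)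
  next
    case False
    have "eventually (\<lambda>k. 1 / real (Suc k) < ?R) sequentially"
      using order_tendstoD(2)[OF LIMSEQ_inverse_real_of_nat R] by (simp add: inverse_eq_divide)
    with x(2) have "\<exists>\<^sub>F k in sequentially. \<phi> x (1 / real (Suc k)) > 0 \<and> 1 / real (Suc k) < ?R"
      unfolding half_dense_def mem_Collect_eq
      by (rule frequently_eventually_conj[THEN frequently_elim1]) (auto simp: \<phi>_def)
    then obtain k where k: "\<phi> x (1 / real (Suc k)) > 0" "1 / real (Suc k) < ?R"
      using frequently_ex by blast
    have "\<exists>r\<ge>1 / real (Suc k). r \<le> ?R \<and> \<phi> x r = 0"
      by (rule IVT2') (use k False in \<open>auto intro!: \<phi> continuous_intros\<close>)
    then obtain r where r: "r \<ge> 1 / real (Suc k)" "r \<le> ?R" "\<phi> x r = 0" by auto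
    then have "0 < r" by (meson divide_pos_pos less_le_trans of_nat_0_less_iff zero_less_Suc zero_less_one)
    \<comment> \<open>Here z = x, and the John bound holds because
      \<open>0 powr s = 0\<close>.\<close>
    then show ?thesis
      using that[OF x(1), of r] r \<tau> C\<^sub>J_ge_1 s_ge_1 by (simp add: \<phi>_def)
  qed
qed

text \<open>The radius bound tau d(z)/4 is chosen so that the truncation |x-y| < tau d(y) removes no
  pair in the ball: |x-y| < 2r, d(y) >= d(z) - r, and 2r + tau r <= (3/4) tau d(z).\<close>

lemma energy_density_ball:
  assumes "z \<in> \<Omega>" "0 < r" "r \<le> \<tau> / 4 * d z"
  shows "(\<integral>\<^sup>+y\<in>ball z r. \<integral>\<^sup>+x\<in>ball z r. ennreal (\<bar>h y - h x\<bar> / dist y x powr (real DIM('a) + \<delta>)) \<partial>lborel \<partial>lborel)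
    \<le> (\<integral>\<^sup>+y\<in>ball z r. \<integral>\<^sup>+x. John_kernel \<tau> \<delta> \<Omega> x y * ennreal \<bar>h x - h y\<bar> \<partial>lborel \<partial>lborel)"
proof (intro nn_integral_mono)
  fix y
  have "r \<le> d z"
  proof -
    have "\<tau> / 4 * d z \<le> 1 * d z"
      using \<tau> bdist_pos[OF assms(1)] by (intro mult_right_mono) auto
    with assms(3) show ?thesis by simp
  qed
  then have sub: "ball z r \<subseteq> \<Omega>" using ball_bdist_subset[OF assms(1)] by auto
  have K: "John_kernel \<tau> \<delta> \<Omega> x y = ennreal (1 / dist y x powr (real DIM('a) + \<delta>))" if "x \<in> ball z r" "y \<in> ball z r" for x
  proof -
    have "d z \<le> d y + r" using bdist_Lipschitz[of z y] that(2) by simp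
    moreover have "dist x y < 2 * r" using dist_triangle_less_add[of x z r y r] that by (simp add: dist_commute)
    moreover have "2 * r \<le> \<tau> * (d z - r)"
    proof -
      have "\<tau> * r \<le> \<tau> * (\<tau> / 4 * d z)" using assms(3) \<tau> by (intro mult_left_mono) auto
      also have "\<dots> \<le> 1 * (\<tau> / 4 * d z)"
        using \<tau> bdist_pos[OF assms(1)] by (intro mult_right_mono) auto
      moreover have "0 < \<tau> * d z" using \<tau> bdist_pos[OF assms(1)] by simp
      ultimately show ?thesis using assms(3) by (simp add: algebra_simps)
    qed
    moreover have "\<tau> * (d z - r) \<le> \<tau> * d y" using \<open>d z \<le> d y + r\<close> \<tau> by (intro mult_left_mono) auto
    ultimately have "norm (x - y) < \<tau> * d y" by (simp add: dist_norm)
    moreover have "x \<in> \<Omega>" "y \<in> \<Omega>" using that sub by blast+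
    ultimately show ?thesis by (simp add: John_kernel_def dist_norm norm_minus_commute)
  qed
  show "(\<integral>\<^sup>+x\<in>ball z r. ennreal (\<bar>h y - h x\<bar> / dist y x powr (real DIM('a) + \<delta>)) \<partial>lborel) * indicator (ball z r) y
     \<le> (\<integral>\<^sup>+x. John_kernel \<tau> \<delta> \<Omega> x y * ennreal \<bar>h x - h y\<bar> \<partial>lborel) * indicator (ball z r) y"
  proof (cases "y \<in> ball z r")
    case True
    have "ennreal (\<bar>h y - h x\<bar> / dist y x powr (real DIM('a) + \<delta>)) * indicator (ball z r) x
        \<le> John_kernel \<tau> \<delta> \<Omega> x y * ennreal \<bar>h x - h y\<bar>" for x
    proof (cases "x \<in> ball z r")
      case x: True
      show ?thesis unfolding K[OF x True] using x
        by (simp add: ennreal_mult[symmetric] abs_minus_commute)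
    qed simp
    then show ?thesis by (intro mult_right_mono nn_integral_mono) auto
  qed simp
qed

lemma borel_measurable_energy_density:
  fixes h :: "'a \<Rightarrow> real"
  assumes [measurable]: "h \<in> borel_measurable borel"
  shows "(\<lambda>y. \<integral>\<^sup>+x. John_kernel \<tau> \<delta> \<Omega> x y * ennreal \<bar>h x - h y\<bar> \<partial>lborel) \<in> borel_measurable borel"
proof -
  note [measurable] = borel_measurable_John_kernel[OF \<Omega>_borel, of \<tau> \<delta>]
  have "(\<lambda>(y, x). John_kernel \<tau> \<delta> \<Omega> x y * ennreal \<bar>h x - h y\<bar>) \<in> borel_measurable (borel \<Otimes>\<^sub>M lborel)"
    by measurable
  then show ?thesis
    by (rule lborel.borel_measurable_nn_integral)
qed

section \<open>Comparison of scales and the constants of the covering argument\<close>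

definition M :: real where
  "M = 2 powr s * (4 * C\<^sub>J / \<tau> + max 1 D powr s)"

text \<open>The power of 2 and the squared volume come from the isoperimetric inequality;
  \<open>M ^ DIM('a)\<close> stands for M^(n - delta), which it bounds since M >= 1, so that delta
  disappears.\<close>

definition C\<^sub>1 :: real where
  "C\<^sub>1 = M ^ DIM('a) * 2 ^ (DIM('a) + 4) / (unit_ball_vol (real DIM('a)))\<^sup>2"

lemma M_ge_1: "1 \<le> M"
proof -
  have "1 \<le> 2 powr s" using s_ge_1 by (intro ge_one_powr_ge_zero) auto
  moreover have "1 \<le> max 1 D powr s" using s_ge_1 by (intro ge_one_powr_ge_zero) auto
  moreover have "0 \<le> 4 * C\<^sub>J / \<tau>" using C\<^sub>J_ge_1 \<tau> by simp
  ultimately have "1 * 1 \<le> 2 powr s * (4 * C\<^sub>J / \<tau> + max 1 D powr s)"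
    by (intro mult_mono) auto
  then show ?thesis by (simp add: M_def)
qed

lemma C\<^sub>1_pos: "0 < C\<^sub>1"
proof -
  have "0 < M" using M_ge_1 by simp
  then show ?thesis
    unfolding C\<^sub>1_def by (intro divide_pos_pos mult_pos_pos zero_less_power unit_ball_vol_pos) auto
qed

lemma exponent_pos: "0 < real DIM('a) - \<delta>"
proof -
  have "1 \<le> real DIM('a)" by (simp add: Suc_leI)
  then show ?thesis using \<delta> by linarith
qed

text \<open>The sum is at most twice its larger term. If |z-x| dominates, the John bound applies; if
  r dominates, r^s = r^(s-1) r with r <= D. The two cases produce the two summands of
  \<open>M\<close>.\<close>

lemma radius_powr_le:
  assumes "z \<in> \<Omega>" "x \<in> \<Omega>" "0 < r" "r \<le> D" "norm (z - x) powr s \<le> 4 * C\<^sub>J / \<tau> * r"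
  shows "(norm (z - x) + r) powr s \<le> M * r"
proof (cases "r \<le> norm (z - x)")
  case True
  have "(norm (z - x) + r) powr s \<le> (2 * norm (z - x)) powr s"
    using True assms s_ge_1 by (intro powr_mono2) auto
  also have "\<dots> = 2 powr s * norm (z - x) powr s" by (simp add: powr_mult)
  also have "\<dots> \<le> 2 powr s * (4 * C\<^sub>J / \<tau> * r)" by (intro mult_left_mono assms) simp
  also have "\<dots> \<le> M * r"
    using assms unfolding M_def by (simp add: mult.assoc distrib_left distrib_right)
  finally show ?thesis .
next
  case False
  have "(norm (z - x) + r) powr s \<le> (2 * r) powr s"
    using False assms s_ge_1 by (intro powr_mono2) auto
  also have "\<dots> = 2 powr s * (r powr (s - 1) * r)"
    using assms by (simp add: powr_mult powr_diff)
  also have "r powr (s - 1) \<le> max 1 D powr (s - 1)"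
    using assms s_ge_1 by (intro powr_mono2) auto
  also have "\<dots> \<le> max 1 D powr s" by (intro powr_mono) auto
  finally have "(norm (z - x) + r) powr s \<le> 2 powr s * (max 1 D powr s * r)"
    using assms by (simp add: mult_left_mono mult_right_mono)
  also have "\<dots> \<le> M * r"
    using assms C\<^sub>J_ge_1 \<tau> unfolding M_def by (simp add: mult.assoc distrib_left distrib_right)
  finally show ?thesis .
qed

text \<open>The half-filled ball need not contain x. The ball around x of radius |z-x| + r contains
  it, and being centered at x it is fit for a Vitali covering of all such x; the price is the
  exponent s(n - delta) in place of n - delta.\<close>

lemma half_dense_scale:
  assumes E: "E \<in> sets borel" and x: "x \<in> \<Omega>" "x \<in> half_dense E"
    and B\<^sub>J: "2 * measure lborel (E \<inter> B\<^sub>J) \<le> measure lborel B\<^sub>J"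
  obtains \<rho> where "0 < \<rho>" "\<rho> \<le> 2 * D"
    "ennreal (\<rho> powr (s * (DIM('a) - \<delta>))) \<le> ennreal (C\<^sub>1 * (1 - \<delta>)) *
      (\<integral>\<^sup>+y\<in>ball x \<rho>. \<integral>\<^sup>+x. John_kernel \<tau> \<delta> \<Omega> x y * ennreal \<bar>indicat_real E x - indicat_real E y\<bar> \<partial>lborel \<partial>lborel)"
proof -
  let ?n = "real DIM('a)" and ?v = "unit_ball_vol (real DIM('a))"
  let ?g = "\<lambda>y. \<integral>\<^sup>+x. John_kernel \<tau> \<delta> \<Omega> x y * ennreal \<bar>indicat_real E x - indicat_real E y\<bar> \<partial>lborel"
  obtain z r where zr: "z \<in> \<Omega>" "0 < r" "r \<le> \<tau> / 4 * d z" "norm (z - x) powr s \<le> 4 * C\<^sub>J / \<tau> * r"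
    and half: "2 * measure lborel (E \<inter> ball z r) = measure lborel (ball z r)"
    using exists_half_ball[OF assms] by blast
  have "\<tau> / 4 * d z \<le> 1 * d z"
    using \<tau> bdist_pos[OF zr(1)] by (intro mult_right_mono) auto
  then have rD: "r \<le> D" using zr(3) bdist_le_D[OF zr(1)] by linarith
  define \<rho> where "\<rho> = norm (z - x) + r"
  have "ball z r \<subseteq> ball x \<rho>"
  proof
    fix y assume "y \<in> ball z r"
    then show "y \<in> ball x \<rho>"
      using dist_triangle[of x y z] by (simp add: \<rho>_def dist_norm norm_minus_commute)
  qed
  have "?v\<^sup>2 * \<rho> powr (s * (?n - \<delta>)) \<le> M ^ DIM('a) * (?v\<^sup>2 * r powr (?n - \<delta>))"
  proof -
    have "\<rho> powr (s * (?n - \<delta>)) = (\<rho> powr s) powr (?n - \<delta>)" by (simp add: powr_powr)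
    also have "\<dots> \<le> (M * r) powr (?n - \<delta>)"
      using radius_powr_le[OF zr(1) x(1) zr(2) rD zr(4)] exponent_pos unfolding \<rho>_def
      by (intro powr_mono2) auto
    also have "\<dots> = M powr (?n - \<delta>) * r powr (?n - \<delta>)" by (simp add: powr_mult)
    also have "M powr (?n - \<delta>) \<le> M powr ?n" using M_ge_1 \<delta> by (intro powr_mono) auto
    also have "M powr ?n = M ^ DIM('a)" using M_ge_1 by (simp add: powr_realpow)
    finally have "\<rho> powr (s * (?n - \<delta>)) \<le> M ^ DIM('a) * r powr (?n - \<delta>)" by (simp add: mult_right_mono)
    then have "?v\<^sup>2 * \<rho> powr (s * (?n - \<delta>)) \<le> ?v\<^sup>2 * (M ^ DIM('a) * r powr (?n - \<delta>))"
      by (rule mult_left_mono) simp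
    then show ?thesis by (simp add: mult_ac)
  qed
  then have "ennreal (?v\<^sup>2 * \<rho> powr (s * (?n - \<delta>))) \<le> ennreal (M ^ DIM('a)) * ennreal (?v\<^sup>2 * r powr (?n - \<delta>))"
    using M_ge_1 by (subst ennreal_mult[symmetric]) (auto intro: ennreal_leI)
  also have "\<dots> \<le> ennreal (M ^ DIM('a)) * (ennreal (2 ^ (DIM('a) + 4) * (1 - \<delta>)) *
      (\<integral>\<^sup>+y\<in>ball z r. \<integral>\<^sup>+x\<in>ball z r. ennreal (\<bar>indicat_real E y - indicat_real E x\<bar> / dist y x powr (real DIM('a) + \<delta>)) \<partial>lborel \<partial>lborel))"
    by (intro mult_left_mono relative_fractional_isoperimetric_ball E zr half \<delta>) simp
  also have "\<dots> \<le> ennreal (M ^ DIM('a)) * (ennreal (2 ^ (DIM('a) + 4) * (1 - \<delta>)) * (\<integral>\<^sup>+y\<in>ball z r. ?g y \<partial>lborel))"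
    by (intro mult_left_mono energy_density_ball zr) simp_all
  also have "\<dots> \<le> ennreal (M ^ DIM('a)) * (ennreal (2 ^ (DIM('a) + 4) * (1 - \<delta>)) * (\<integral>\<^sup>+y\<in>ball x \<rho>. ?g y \<partial>lborel))"
    using \<open>ball z r \<subseteq> ball x \<rho>\<close>
    by (intro mult_left_mono nn_integral_mono) (auto simp: indicator_def)
  finally have main: "ennreal (?v\<^sup>2 * \<rho> powr (s * (?n - \<delta>))) \<le> \<dots>" .
  have v: "0 < ?v\<^sup>2" by (intro zero_less_power unit_ball_vol_pos) simp
  have "ennreal (\<rho> powr (s * (?n - \<delta>))) = ennreal (1 / ?v\<^sup>2) * ennreal (?v\<^sup>2 * \<rho> powr (s * (?n - \<delta>)))"
    using v by (subst ennreal_mult[symmetric]) auto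
  also have "\<dots> \<le> ennreal (1 / ?v\<^sup>2) * (ennreal (M ^ DIM('a)) * (ennreal (2 ^ (DIM('a) + 4) * (1 - \<delta>)) * (\<integral>\<^sup>+y\<in>ball x \<rho>. ?g y \<partial>lborel)))"
    by (intro mult_left_mono main) simp
  also have "\<dots> = ennreal (1 / ?v\<^sup>2 * (M ^ DIM('a) * (2 ^ (DIM('a) + 4) * (1 - \<delta>)))) * (\<integral>\<^sup>+y\<in>ball x \<rho>. ?g y \<partial>lborel)"
    using M_ge_1 \<delta> v by (simp only: ennreal_mult zero_le_mult_iff zero_le_power zero_le_divide_iff zero_le_numeral mult.assoc
        diff_ge_0_iff_ge less_imp_le zero_le_one order_trans[OF zero_le_one M_ge_1] simp_thms)
  also have "1 / ?v\<^sup>2 * (M ^ DIM('a) * (2 ^ (DIM('a) + 4) * (1 - \<delta>))) = C\<^sub>1 * (1 - \<delta>)"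
    by (simp add: C\<^sub>1_def)
  finally have "ennreal (\<rho> powr (s * (?n - \<delta>))) \<le> ennreal (C\<^sub>1 * (1 - \<delta>)) * (\<integral>\<^sup>+y\<in>ball x \<rho>. ?g y \<partial>lborel)" .
  moreover have "0 < \<rho>" "\<rho> \<le> 2 * D"
    using zr(2) rD dist_le_D[OF zr(1) x(1)] by (auto simp: \<rho>_def dist_norm add_nonneg_pos)
  ultimately show thesis by (rule that[rotated 2])
qed

text \<open>The 5 is the enlargement in the Vitali covering, with 5^(s(n - delta)) <= 5^n.\<close>

definition \<kappa> :: real where
  "\<kappa> = 5 ^ DIM('a) * C\<^sub>1"

lemma \<kappa>_pos: "0 < \<kappa>"
  using C\<^sub>1_pos by (simp add: \<kappa>_def)

text \<open>The growth bound is a constant times the q-th power of the quantity that each covering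
  ball bounds by its energy, so the measures of the enlarged balls add up like q-th powers of
  disjoint energies. The enlarged radii are at most 5 * 2 D, which explains the range in
  \<open>growth\<close>.\<close>

theorem boxing_inequality:
  assumes sets_\<mu>: "sets \<mu> = sets borel" and C\<^sub>\<mu>: "0 \<le> C\<^sub>\<mu>" and q: "1 \<le> q"
    and growth: "\<And>x r. 0 < r \<Longrightarrow> r \<le> 10 * D \<Longrightarrow>
      emeasure \<mu> (ball x r) \<le> ennreal (C\<^sub>\<mu> * r powr (q * (s * (DIM('a) - \<delta>))))"
    and E: "E \<in> sets borel"
    and B\<^sub>J: "2 * measure lborel (E \<inter> B\<^sub>J) \<le> measure lborel B\<^sub>J"
    and p: "0 \<le> p" "John_energy \<tau> \<delta> \<Omega> (indicat_real E) \<le> ennreal p"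
  shows "emeasure \<mu> (\<Omega> \<inter> half_dense E) \<le> ennreal (C\<^sub>\<mu> * (\<kappa> * (1 - \<delta>) * p) powr q)"
proof (cases "\<Omega> \<inter> half_dense E = {}")
  case False
  let ?\<beta> = "s * (real DIM('a) - \<delta>)"
  let ?S = "\<Omega> \<inter> half_dense E"
  define g where "g = (\<lambda>y. \<integral>\<^sup>+x. John_kernel \<tau> \<delta> \<Omega> x y * ennreal \<bar>indicat_real E x - indicat_real E y\<bar> \<partial>lborel)"
  \<comment> \<open>With the energy density regarded as a measure, disjointness of the balls bounds
    the sum of their local energies by the total energy.\<close>
  define N where "N = density lborel g"
  have g [measurable]: "g \<in> borel_measurable borel"
    unfolding g_def by (rule borel_measurable_energy_density) (use E in \<open>simp add: borel_measurable_indicator\<close>)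
  have sN [measurable_cong, simp]: "sets N = sets borel" by (simp add: N_def)
  have "\<exists>\<rho>>0. \<rho> \<le> 2 * D \<and> ennreal (\<rho> powr ?\<beta>) \<le> ennreal (C\<^sub>1 * (1 - \<delta>)) * emeasure N (ball x \<rho>)" if "x \<in> ?S" for x
  proof -
    from that have "x \<in> \<Omega>" "x \<in> half_dense E" by auto
    then obtain \<rho> where "0 < \<rho>" "\<rho> \<le> 2 * D"
      "ennreal (\<rho> powr ?\<beta>) \<le> ennreal (C\<^sub>1 * (1 - \<delta>)) * (\<integral>\<^sup>+y\<in>ball x \<rho>. g y \<partial>lborel)"
      unfolding g_def by (rule half_dense_scale[OF E _ _ B\<^sub>J])
    then show ?thesis by (auto simp: N_def emeasure_density)
  qed
  then obtain \<rho> where \<rho>: "\<And>x. x \<in> ?S \<Longrightarrow> 0 < \<rho> x" "\<And>x. x \<in> ?S \<Longrightarrow> \<rho> x \<le> 2 * D"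
    and \<rho>N: "\<And>x. x \<in> ?S \<Longrightarrow> ennreal (\<rho> x powr ?\<beta>) \<le> ennreal (C\<^sub>1 * (1 - \<delta>)) * emeasure N (ball x (\<rho> x))"
    by metis
  have "?S \<subseteq> (\<Union>x\<in>?S. ball x (\<rho> x))" using \<rho>(1) by fastforce
  then obtain C where C: "countable C" "C \<subseteq> ?S"
     and disj: "pairwise (\<lambda>i j. disjnt (ball i (\<rho> i)) (ball j (\<rho> j))) C"
     and cover: "?S \<subseteq> (\<Union>i\<in>C. ball i (5 * \<rho> i))"
    by (rule Vitali_covering_lemma_balls[where B = "2 * D" and a = "\<lambda>x. x" and r = \<rho>]) (use \<rho> in auto)
  \<comment> \<open>\<open>C\<close> may be finite; indices outside its enumeration get the empty
    set, so that series over all naturals can be used.\<close>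
  define B where "B n = (if n \<in> to_nat_on C ` C then ball (from_nat_into C n) (\<rho> (from_nat_into C n)) else {})" for n
  define B' where "B' n = (if n \<in> to_nat_on C ` C then ball (from_nat_into C n) (5 * \<rho> (from_nat_into C n)) else {})" for n
  have fromC: "from_nat_into C n \<in> C" if "n \<in> to_nat_on C ` C" for n
    using that C(1) by auto
  have disjB: "disjoint_family B"
    unfolding disjoint_family_on_def B_def
  proof (intro ballI impI)
    fix m n :: nat assume "m \<noteq> n"
    show "(if m \<in> to_nat_on C ` C then ball (from_nat_into C m) (\<rho> (from_nat_into C m)) else {}) \<inter>
          (if n \<in> to_nat_on C ` C then ball (from_nat_into C n) (\<rho> (from_nat_into C n)) else {}) = {}"
    proof (cases "m \<in> to_nat_on C ` C \<and> n \<in> to_nat_on C ` C")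
      case True
      then have "from_nat_into C m \<noteq> from_nat_into C n"
        using \<open>m \<noteq> n\<close> C(1) by (metis from_nat_into_to_nat_on imageE)
      then show ?thesis
        using True disj fromC unfolding pairwise_def disjnt_def by auto
    qed auto
  qed
  have Bm [measurable]: "B n \<in> sets borel" "B' n \<in> sets borel" for n
    by (auto simp: B_def B'_def)
  define a where "a n = enn2real (emeasure N (B n))" for n
  have "(\<Sum>n. emeasure N (B n)) = emeasure N (\<Union>n. B n)"
    using disjB by (intro suminf_emeasure) auto
  also have "\<dots> \<le> emeasure N UNIV" by (intro emeasure_mono) auto
  also have "\<dots> = John_energy \<tau> \<delta> \<Omega> (indicat_real E)"
    by (simp add: N_def emeasure_density John_energy_def g_def[symmetric])
  also note p(2)
  finally have sum_N: "(\<Sum>n. emeasure N (B n)) \<le> ennreal p" .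
  have a: "ennreal (a n) = emeasure N (B n)" for n
  proof -
    have "emeasure N (B n) \<le> (\<Sum>n. emeasure N (B n))"
      using sum_le_suminf[of "\<lambda>n. emeasure N (B n)" "{n}"] by simp
    also note sum_N
    finally have "emeasure N (B n) < top" by (simp add: le_less_trans)
    then show ?thesis by (simp add: a_def)
  qed
  have a_nonneg: "0 \<le> a n" for n by (simp add: a_def)
  have c: "0 \<le> \<kappa> * (1 - \<delta>)" using \<kappa>_pos \<delta> by simp
  have B': "emeasure \<mu> (B' n) \<le> ennreal C\<^sub>\<mu> * ennreal ((\<kappa> * (1 - \<delta>) * a n) powr q)" for n
  proof (cases "n \<in> to_nat_on C ` C")
    case True
    define x where "x = from_nat_into C n"
    have xC: "x \<in> ?S" using fromC[OF True] C(2) by (auto simp: x_def)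
    have Bn: "B n = ball x (\<rho> x)" "B' n = ball x (5 * \<rho> x)"
      using True by (simp_all add: B_def B'_def x_def)
    have "ennreal (\<rho> x powr ?\<beta>) \<le> ennreal (C\<^sub>1 * (1 - \<delta>)) * ennreal (a n)"
      using \<rho>N[OF xC] by (simp add: a Bn)
    also have "\<dots> = ennreal (C\<^sub>1 * (1 - \<delta>) * a n)"
      using C\<^sub>1_pos \<delta> a_nonneg[of n] by (subst ennreal_mult) auto
    finally have le: "\<rho> x powr ?\<beta> \<le> C\<^sub>1 * (1 - \<delta>) * a n"
      using C\<^sub>1_pos \<delta> a_nonneg[of n] by (subst (asm) ennreal_le_iff) auto
    have "5 powr ?\<beta> \<le> 5 powr real DIM('a)" using s_le by (intro powr_mono) auto
    also have "\<dots> = 5 ^ DIM('a)" by (simp add: powr_realpow)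
    finally have "5 powr ?\<beta> * \<rho> x powr ?\<beta> \<le> 5 ^ DIM('a) * (C\<^sub>1 * (1 - \<delta>) * a n)"
      using le by (intro mult_mono) auto
    then have "(5 * \<rho> x) powr ?\<beta> \<le> \<kappa> * (1 - \<delta>) * a n"
      by (simp add: powr_mult \<kappa>_def mult.assoc)
    then have "((5 * \<rho> x) powr ?\<beta>) powr q \<le> (\<kappa> * (1 - \<delta>) * a n) powr q"
      using q by (intro powr_mono2) auto
    then have "C\<^sub>\<mu> * (5 * \<rho> x) powr (q * ?\<beta>) \<le> C\<^sub>\<mu> * (\<kappa> * (1 - \<delta>) * a n) powr q"
      using C\<^sub>\<mu> by (intro mult_left_mono) (auto simp: powr_powr mult.commute)
    moreover have "emeasure \<mu> (B' n) \<le> ennreal (C\<^sub>\<mu> * (5 * \<rho> x) powr (q * ?\<beta>))"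
      unfolding Bn using \<rho>[OF xC] by (intro growth) auto
    ultimately show ?thesis
      using C\<^sub>\<mu> by (subst ennreal_mult[symmetric]) (auto intro: order_trans ennreal_leI)
  qed (simp add: B'_def)
  have "?S \<subseteq> (\<Union>n. B' n)"
  proof
    fix x assume "x \<in> ?S"
    then obtain i where i: "i \<in> C" "x \<in> ball i (5 * \<rho> i)" using cover by auto
    then have "x \<in> B' (to_nat_on C i)" using C(1) by (simp add: B'_def)
    then show "x \<in> (\<Union>n. B' n)" by blast
  qed
  moreover have B'\<mu>: "range B' \<subseteq> sets \<mu>" using Bm(2) by (auto simp: sets_\<mu>)
  ultimately have "emeasure \<mu> ?S \<le> emeasure \<mu> (\<Union>n. B' n)"
    by (intro emeasure_mono sets.countable_UN)
  also have "\<dots> \<le> (\<Sum>n. emeasure \<mu> (B' n))"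
    by (rule emeasure_subadditive_countably[OF B'\<mu>])
  also have "\<dots> \<le> (\<Sum>n. ennreal C\<^sub>\<mu> * ennreal ((\<kappa> * (1 - \<delta>) * a n) powr q))"
    by (intro suminf_le summableI B')
  also have "\<dots> = ennreal C\<^sub>\<mu> * (\<Sum>n. ennreal ((\<kappa> * (1 - \<delta>) * a n) powr q))"
    by (rule ennreal_suminf_cmult)
  also have "\<dots> \<le> ennreal C\<^sub>\<mu> * ennreal ((\<kappa> * (1 - \<delta>) * p) powr q)"
  proof (intro mult_left_mono suminf_powr_le q)
    have "(\<Sum>n. ennreal (\<kappa> * (1 - \<delta>) * a n)) = ennreal (\<kappa> * (1 - \<delta>)) * (\<Sum>n. ennreal (a n))"
      using c a_nonneg by (simp only: ennreal_mult flip: ennreal_suminf_cmult)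
    also have "\<dots> \<le> ennreal (\<kappa> * (1 - \<delta>)) * ennreal p"
      unfolding a by (intro mult_left_mono sum_N) simp
    also have "\<dots> = ennreal (\<kappa> * (1 - \<delta>) * p)"
      using c p by (subst ennreal_mult) auto
    finally show "(\<Sum>n. ennreal (\<kappa> * (1 - \<delta>) * a n)) \<le> ennreal (\<kappa> * (1 - \<delta>) * p)" .
  qed (use c a_nonneg p in auto)
  also have "\<dots> = ennreal (C\<^sub>\<mu> * (\<kappa> * (1 - \<delta>) * p) powr q)"
    using C\<^sub>\<mu> by (subst ennreal_mult) auto
  finally show ?thesis .
qed simp

end

section \<open>From sets to functions\<close>

text \<open>For fixed x and y the two indicators differ only for t between h x and h y; Tonelli does
  the rest. The kernel may be asymmetric, as the truncation by d(y) is.\<close>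

lemma coarea_le:
  fixes K :: "'a::euclidean_space \<Rightarrow> 'a \<Rightarrow> ennreal" and h :: "'a \<Rightarrow> real"
  assumes K [measurable]: "(\<lambda>(x, y). K x y) \<in> borel_measurable (borel \<Otimes>\<^sub>M borel)"
    and h [measurable]: "h \<in> borel_measurable borel"
  defines "P \<equiv> \<lambda>t. \<integral>\<^sup>+y. \<integral>\<^sup>+x. K x y * ennreal \<bar>indicat_real {z. t < h z} x - indicat_real {z. t < h z} y\<bar> \<partial>lborel \<partial>lborel"
  shows "P \<in> borel_measurable borel"
    and "(\<integral>\<^sup>+t. P t \<partial>lborel) \<le> (\<integral>\<^sup>+y. \<integral>\<^sup>+x. K x y * ennreal \<bar>h x - h y\<bar> \<partial>lborel \<partial>lborel)"
proof -
  let ?i = "\<lambda>t x y. ennreal \<bar>(if t < h x then 1 else 0) - (if t < h y then 1 else 0 :: real)\<bar>"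
  have P: "P = (\<lambda>t. \<integral>\<^sup>+y. \<integral>\<^sup>+x. K x y * ?i t x y \<partial>lborel \<partial>lborel)"
    by (simp add: P_def indicator_def of_bool_def)
  have [measurable]: "(\<lambda>w. K (f w) (g w)) \<in> borel_measurable N"
    if "f \<in> N \<rightarrow>\<^sub>M borel" "g \<in> N \<rightarrow>\<^sub>M borel" for f g and N :: "'b measure"
    using measurable_compose[OF measurable_Pair[OF that] K] by simp
  have m2 [measurable]: "(\<lambda>(t, y). \<integral>\<^sup>+x. K x y * ?i t x y \<partial>lborel) \<in> borel_measurable (lborel \<Otimes>\<^sub>M lborel)"
    unfolding case_prod_beta by measurable
  show "P \<in> borel_measurable borel"
    unfolding P by measurable
  have "(\<integral>\<^sup>+t. P t \<partial>lborel) = (\<integral>\<^sup>+y. \<integral>\<^sup>+t. \<integral>\<^sup>+x. K x y * ?i t x y \<partial>lborel \<partial>lborel \<partial>lborel)"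
    unfolding P by (rule lborel_pair.Fubini'[symmetric]) measurable
  also have "\<dots> = (\<integral>\<^sup>+y. \<integral>\<^sup>+x. \<integral>\<^sup>+t. K x y * ?i t x y \<partial>lborel \<partial>lborel \<partial>lborel)"
    by (intro nn_integral_cong lborel_pair.Fubini'[symmetric]) measurable
  also have "\<dots> \<le> (\<integral>\<^sup>+y. \<integral>\<^sup>+x. K x y * ennreal \<bar>h x - h y\<bar> \<partial>lborel \<partial>lborel)"
  proof (intro nn_integral_mono)
    fix x y
    have "(\<integral>\<^sup>+t. K x y * ?i t x y \<partial>lborel) = K x y * (\<integral>\<^sup>+t. ?i t x y \<partial>lborel)"
      by (rule nn_integral_cmult) measurable
    also have "(\<integral>\<^sup>+t. ?i t x y \<partial>lborel) \<le> (\<integral>\<^sup>+t. indicator {min (h x) (h y)..max (h x) (h y)} t \<partial>lborel)"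
      by (intro nn_integral_mono) (auto simp: indicator_def)
    also have "\<dots> = ennreal \<bar>h x - h y\<bar>"
      by (simp add: abs_real_def max_def min_def)
    finally show "(\<integral>\<^sup>+t. K x y * ?i t x y \<partial>lborel) \<le> K x y * ennreal \<bar>h x - h y\<bar>"
      by (simp add: mult_left_mono)
  qed
  finally show "(\<integral>\<^sup>+t. P t \<partial>lborel) \<le> (\<integral>\<^sup>+y. \<integral>\<^sup>+x. K x y * ennreal \<bar>h x - h y\<bar> \<partial>lborel \<partial>lborel)" .
qed

context John_domain
begin

text \<open>For \<open>u > 0\<close> with \<open>2 powr k < u \<le> 2 powr (k + 1)\<close> the term of the integer \<open>k\<close> alone dominates
  \<open>u powr q\<close>. This makes the sum a Borel majorant of the \<open>q\<close>-th power of the positive part of the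
  precise representative of \<open>h\<close>.\<close>

definition level_sum :: "real \<Rightarrow> ('a \<Rightarrow> real) \<Rightarrow> 'a \<Rightarrow> ennreal" where
  "level_sum q h x = (\<Sum>i. ennreal (2 powr (q * (real_of_int (int_decode i) + 1))) *
     indicator (\<Omega> \<inter> half_dense {y. 2 powr real_of_int (int_decode i) < h y}) x)"

lemma borel_measurable_level_sum [measurable]:
  assumes [measurable]: "h \<in> borel_measurable borel"
  shows "level_sum q h \<in> borel_measurable borel"
proof -
  have [measurable]: "half_dense {y. 2 powr real_of_int (int_decode i) < h y} \<in> sets borel" for i
    by (rule half_dense_borel) measurable
  show ?thesis unfolding level_sum_def by measurable
qed

lemma powr_le_level_sum:
  assumes q: "0 < q" and x: "x \<in> \<Omega>" and u: "\<And>t. 0 < t \<Longrightarrow> t < u \<Longrightarrow> x \<in> half_dense {y. t < h y}"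
  shows "ennreal (max 0 u powr q) \<le> level_sum q h x"
proof (cases "0 < u")
  case True
  \<comment> \<open>The ceiling makes 2^k < u strict, since the hypothesis speaks only of levels
    below u.\<close>
  define k where "k = \<lceil>log 2 u\<rceil> - 1"
  have k: "real_of_int k < log 2 u" "log 2 u \<le> real_of_int k + 1" unfolding k_def by linarith+
  have "2 powr k < u" using k(1) True by (simp add: less_log_iff)
  have "u \<le> 2 powr (k + 1)" using k(2) True by (simp add: log_le_iff)
  have "ennreal (max 0 u powr q) \<le> ennreal ((2 powr (k + 1)) powr q)"
    using \<open>u \<le> 2 powr (k + 1)\<close> True q by (intro ennreal_leI powr_mono2) auto
  also have "\<dots> = ennreal (2 powr (q * (k + 1))) * indicator (\<Omega> \<inter> half_dense {y. 2 powr k < h y}) x"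
    using u[of "2 powr k"] \<open>2 powr k < u\<close> x by (simp add: powr_powr mult.commute)
  also have "\<dots> \<le> level_sum q h x"
    unfolding level_sum_def
    using sum_le_suminf[of "\<lambda>i. ennreal (2 powr (q * (real_of_int (int_decode i) + 1))) *
     indicator (\<Omega> \<inter> half_dense {y. 2 powr real_of_int (int_decode i) < h y}) x" "{int_encode k}"] by simp
  finally show ?thesis .
qed (use q in simp)

text \<open>For t in (2^(k-1), 2^k] the superlevel set contains that of level 2^k, so one lower
  bound for the energy holds on the whole range. The ranges are disjoint, so by coarea the lengths
  times these bounds add up to at most the energy of h; this is what turns bounds on single levels
  into a strong-type bound.\<close>

lemma nn_integral_level_sum_le:
  assumes sets_\<mu>: "sets \<mu> = sets borel" and C\<^sub>\<mu>: "0 < C\<^sub>\<mu>" and q: "1 \<le> q"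
    and growth: "\<And>x r. 0 < r \<Longrightarrow> r \<le> 10 * D \<Longrightarrow>
      emeasure \<mu> (ball x r) \<le> ennreal (C\<^sub>\<mu> * r powr (q * (s * (DIM('a) - \<delta>))))"
    and h [measurable]: "h \<in> borel_measurable borel"
    and B\<^sub>J: "2 * measure lborel ({y. 0 < h y} \<inter> B\<^sub>J) \<le> measure lborel B\<^sub>J"
    and p: "0 \<le> p" "John_energy \<tau> \<delta> \<Omega> h \<le> ennreal p"
  shows "(\<integral>\<^sup>+x. level_sum q h x \<partial>\<mu>) \<le> ennreal (C\<^sub>\<mu> * (4 * \<kappa> * (1 - \<delta>) * p) powr q)"
proof -
  define k where "k i = real_of_int (int_decode i)" for i
  define S where "S i = \<Omega> \<inter> half_dense {y. 2 powr k i < h y}" for i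
  define I where "I i = {2 powr (k i - 1)<..2 powr k i}" for i
  define P where "P = (\<lambda>t. John_energy \<tau> \<delta> \<Omega> (indicat_real {z. t < h z}))"
  define c where "c = \<kappa> * (1 - \<delta>)"
  have c: "0 < c" using \<kappa>_pos \<delta> by (simp add: c_def)
  note [measurable] = borel_measurable_John_kernel[OF \<Omega>_borel, of \<tau> \<delta>]
  have P_meas [measurable]: "P \<in> borel_measurable borel"
    and P_int: "(\<integral>\<^sup>+t. P t \<partial>lborel) \<le> ennreal p"
    using coarea_le[of "John_kernel \<tau> \<delta> \<Omega>" h] p(2)
    by (auto simp: P_def John_energy_def intro: order_trans)
  have half_borel: "half_dense {y. t < h y} \<in> sets borel" for t
    by (rule half_dense_borel) measurable
  then have S_borel: "S i \<in> sets \<mu>" for i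
    by (simp add: S_def sets_\<mu> sets.Int)
  \<comment> \<open>\<open>measure\<close> returns 0 on sets of infinite measure, so finiteness is
    needed for \<open>Q i\<close> to carry the value of \<open>\<mu>\<close> on
    \<open>S i\<close>.\<close>
  have fin: "emeasure \<mu> A < \<infinity>" if "A \<subseteq> \<Omega>" for A
  proof -
    have "A \<subseteq> ball x\<^sub>J (2 * D)"
      using that dist_le_D[OF center] D_pos by fastforce
    then have "emeasure \<mu> A \<le> emeasure \<mu> (ball x\<^sub>J (2 * D))"
      by (intro emeasure_mono) (simp_all add: sets_\<mu>)
    also have "\<dots> \<le> ennreal (C\<^sub>\<mu> * (2 * D) powr (q * (s * (DIM('a) - \<delta>))))"
      using D_pos by (intro growth) auto
    finally show ?thesis by (simp add: le_less_trans)
  qed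
  \<comment> \<open>\<open>Q i\<close> is the smallest energy that the boxing inequality allows for a set whose half-dense
    part contains \<open>S i\<close>, hence a lower bound for \<open>P\<close> on all of \<open>I i\<close>.\<close>
  define Q where "Q i = (measure \<mu> (S i) / C\<^sub>\<mu>) powr (1 / q) / c" for i
  have S_eq: "emeasure \<mu> (S i) = ennreal (C\<^sub>\<mu> * (c * Q i) powr q)" for i
  proof -
    have "(c * Q i) powr q = measure \<mu> (S i) / C\<^sub>\<mu>"
      using c C\<^sub>\<mu> q by (simp add: Q_def powr_powr)
    then show ?thesis
      using C\<^sub>\<mu> fin[of "S i"] by (simp add: S_def emeasure_eq_ennreal_measure less_top)
  qed
  have Q_le: "ennreal (Q i) \<le> P t" if t: "t \<in> I i" for i t
  proof (cases "P t = \<infinity>")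
    case False
    define p' where "p' = enn2real (P t)"
    have p': "P t = ennreal p'" "0 \<le> p'" using False by (auto simp: p'_def less_top)
    have "0 < 2 powr (k i - 1)" by simp
    then have t0: "0 < t" using t unfolding I_def greaterThanAtMost_iff by linarith
    have "2 * measure lborel ({y. t < h y} \<inter> B\<^sub>J) \<le> 2 * measure lborel ({y. 0 < h y} \<inter> B\<^sub>J)"
      using t0 by (intro mult_left_mono measure_Int_ball_mono) (auto, measurable)
    with B\<^sub>J have B: "2 * measure lborel ({y. t < h y} \<inter> B\<^sub>J) \<le> measure lborel B\<^sub>J" by linarith
    have "S i \<subseteq> \<Omega> \<inter> half_dense {y. t < h y}"
    proof -
      have "{y. 2 powr k i < h y} \<subseteq> {y. t < h y}" using t by (auto simp: I_def)
      then have "half_dense {y. 2 powr k i < h y} \<subseteq> half_dense {y. t < h y}"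
        by (rule half_dense_mono) measurable
      then show ?thesis by (auto simp: S_def)
    qed
    then have "emeasure \<mu> (S i) \<le> emeasure \<mu> (\<Omega> \<inter> half_dense {y. t < h y})"
      using half_borel by (intro emeasure_mono) (auto simp: sets_\<mu>)
    also have "\<dots> \<le> ennreal (C\<^sub>\<mu> * (\<kappa> * (1 - \<delta>) * p') powr q)"
      by (rule boxing_inequality[OF sets_\<mu> less_imp_le[OF C\<^sub>\<mu>] q growth _ B p'(2)])
         (auto simp: p'(1)[symmetric] P_def)
    finally have "(c * Q i) powr q \<le> (c * p') powr q"
      using C\<^sub>\<mu> unfolding S_eq c_def by simp
    then have "c * Q i \<le> c * p'"
      using c p' q by (metis linorder_not_less mult_nonneg_nonneg less_imp_le powr_less_mono2 order_less_le_trans zero_less_one)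
    then show ?thesis using c p' by (simp add: ennreal_leI)
  qed simp
  define a where "a i = 2 powr (k i - 1) * Q i" for i
  have a_nonneg: "0 \<le> a i" for i using c by (simp add: a_def Q_def)
  have disj: "disjoint_family I"
  proof -
    have "I i \<inter> I j = {}" if "k i < k j" for i j
    proof -
      have "int_decode i \<le> int_decode j - 1" using that by (simp add: k_def)
      then have "k i \<le> k j - 1" unfolding k_def by linarith
      then have "2 powr k i \<le> 2 powr (k j - 1)" by (intro powr_mono) auto
      then show ?thesis by (auto simp: I_def)
    qed
    moreover have "k i \<noteq> k j" if "i \<noteq> j" for i j
      using that inj_int_decode[of UNIV] by (simp add: k_def inj_eq)
    ultimately show ?thesis
      unfolding disjoint_family_on_def by (metis Int_commute linorder_neqE)
  qed
  have [measurable]: "I i \<in> sets borel" for i by (simp add: I_def)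
  have "(\<Sum>i. ennreal (a i)) \<le> (\<Sum>i. emeasure (density lborel P) (I i))"
  proof (intro suminf_le summableI)
    fix i
    have "emeasure lborel (I i) = ennreal (2 powr (k i - 1))"
      by (simp add: I_def powr_diff)
    moreover have "0 \<le> Q i" using c by (simp add: Q_def)
    ultimately have "ennreal (a i) = (\<integral>\<^sup>+t\<in>I i. ennreal (Q i) \<partial>lborel)"
      by (simp add: a_def nn_integral_cmult_indicator ennreal_mult mult.commute)
    also have "\<dots> \<le> (\<integral>\<^sup>+t\<in>I i. P t \<partial>lborel)"
      by (intro nn_integral_mono) (auto split: split_indicator intro: Q_le)
    also have "\<dots> = emeasure (density lborel P) (I i)"
      by (simp add: emeasure_density)
    finally show "ennreal (a i) \<le> emeasure (density lborel P) (I i)" .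
  qed
  also have "\<dots> = emeasure (density lborel P) (\<Union>i. I i)"
    using disj by (intro suminf_emeasure) auto
  also have "\<dots> \<le> emeasure (density lborel P) UNIV"
    by (intro emeasure_mono) auto
  also have "\<dots> = (\<integral>\<^sup>+t. P t \<partial>lborel)"
    by (simp add: emeasure_density)
  also note P_int
  finally have sum_a: "(\<Sum>i. ennreal (a i)) \<le> ennreal p" .
  have "(\<integral>\<^sup>+x. level_sum q h x \<partial>\<mu>) = (\<Sum>i. \<integral>\<^sup>+x. ennreal (2 powr (q * (k i + 1))) * indicator (S i) x \<partial>\<mu>)"
    unfolding level_sum_def k_def[symmetric] S_def[symmetric]
    using S_borel by (intro nn_integral_suminf) simp
  also have "\<dots> = (\<Sum>i. ennreal C\<^sub>\<mu> * ennreal ((4 * c * a i) powr q))"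
  proof (rule arg_cong[where f = suminf], rule ext)
    fix i
    \<comment> \<open>The 4 is the ratio of the height 2^(k+1) in the majorant to the length 2^(k-1)
      of the range of levels.\<close>
    have "(4 * c * a i) powr q = (2 powr (k i + 1) * (c * Q i)) powr q"
      by (simp add: a_def powr_add powr_diff mult_ac)
    also have "\<dots> = 2 powr (q * (k i + 1)) * (c * Q i) powr q"
      by (simp add: powr_mult powr_powr mult.commute)
    finally have "C\<^sub>\<mu> * (4 * c * a i) powr q = 2 powr (q * (k i + 1)) * (C\<^sub>\<mu> * (c * Q i) powr q)" by simp
    then show "(\<integral>\<^sup>+x. ennreal (2 powr (q * (k i + 1))) * indicator (S i) x \<partial>\<mu>)
        = ennreal C\<^sub>\<mu> * ennreal ((4 * c * a i) powr q)"
      using S_borel C\<^sub>\<mu> by (simp add: nn_integral_cmult_indicator S_eq ennreal_mult[symmetric])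
  qed
  also have "\<dots> = ennreal C\<^sub>\<mu> * (\<Sum>i. ennreal ((4 * c * a i) powr q))"
    by (rule ennreal_suminf_cmult)
  also have "\<dots> \<le> ennreal C\<^sub>\<mu> * ennreal ((4 * c * p) powr q)"
  proof (intro mult_left_mono suminf_powr_le q)
    have "(\<Sum>i. ennreal (4 * c * a i)) = ennreal (4 * c) * (\<Sum>i. ennreal (a i))"
      using c a_nonneg by (simp add: ennreal_mult flip: ennreal_suminf_cmult)
    also have "\<dots> \<le> ennreal (4 * c) * ennreal p"
      by (intro mult_left_mono sum_a) simp
    also have "\<dots> = ennreal (4 * c * p)"
      using c p by (subst ennreal_mult) auto
    finally show "(\<Sum>i. ennreal (4 * c * a i)) \<le> ennreal (4 * c * p)" .
  qed (use c a_nonneg p in auto)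
  also have "\<dots> = ennreal (C\<^sub>\<mu> * (4 * \<kappa> * (1 - \<delta>) * p) powr q)"
    using C\<^sub>\<mu> by (simp add: ennreal_mult c_def mult.assoc)
  finally show ?thesis .
qed

end

section \<open>Medians and Lebesgue values\<close>

text \<open>m is the infimum of the levels whose strict superlevel set fills at most half of the
  ball. The sets at m are increasing unions of sets at levels m + 1/k and m - 1/k, so continuity
  from below carries the bounds over. Sublevel sets are taken non-strict to be exact
  complements.\<close>

lemma exists_median:
  fixes g :: "'a::euclidean_space \<Rightarrow> real"
  assumes [measurable]: "g \<in> borel_measurable borel" and r: "0 < r"
  obtains m where "2 * measure lborel ({y. m < g y} \<inter> ball z r) \<le> measure lborel (ball z r)"
    "2 * measure lborel ({y. g y < m} \<inter> ball z r) \<le> measure lborel (ball z r)"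
proof -
  let ?B = "ball z r"
  define u where "u t = measure lborel ({y. t < g y} \<inter> ?B)" for t
  define w where "w t = measure lborel ({y. g y \<le> t} \<inter> ?B)" for t
  define V where "V = measure lborel ?B"
  have V: "0 < V" using r by (simp add: V_def)
  have meas [simp]: "{y. t < g y} \<in> sets borel" "{y. g y \<le> t} \<in> sets borel" for t
    by measurable
  then have fin [simp]: "emeasure lborel ({y. t < g y} \<inter> ?B) \<noteq> top" "emeasure lborel ({y. g y \<le> t} \<inter> ?B) \<noteq> top" for t
    using fmeasurable_Int_fmeasurable[of ?B lborel] by (simp_all only: Int_commute[of _ ?B] fmeasurableD2 fmeasurable_ball sets_lborel infinity_ennreal_def not_False_eq_True)
  have uw: "u t + w t = V" for t
  proof -
    have "measure lborel (({y. t < g y} \<inter> ?B) \<union> ({y. g y \<le> t} \<inter> ?B)) = u t + w t"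
      unfolding u_def w_def by (rule measure_Union) auto
    moreover have "({y. t < g y} \<inter> ?B) \<union> ({y. g y \<le> t} \<inter> ?B) = ?B" by auto
    ultimately show ?thesis by (simp add: V_def)
  qed
  have anti: "u t \<le> u t'" if "t' \<le> t" for t t'
    unfolding u_def using that by (intro measure_Int_ball_mono) auto
  have lim0: "(\<lambda>n. u (real n)) \<longlonglongrightarrow> 0"
  proof -
    have "(\<lambda>n. measure lborel ({y. real n < g y} \<inter> ?B)) \<longlonglongrightarrow> measure lborel (\<Inter>n. {y. real n < g y} \<inter> ?B)"
      by (rule Lim_measure_decseq) (auto simp: decseq_def)
    moreover have "(\<Inter>n. {y. real n < g y} \<inter> ?B) = {}"
    proof -
      have "\<exists>n. \<not> real n < g y" for y
        using reals_Archimedean2[of "g y"] by (meson less_asym)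
      then show ?thesis by auto
    qed
    ultimately show ?thesis by (simp add: u_def)
  qed
  have limV: "(\<lambda>n. w (- real n)) \<longlonglongrightarrow> 0"
  proof -
    have "(\<lambda>n. measure lborel ({y. g y \<le> - real n} \<inter> ?B)) \<longlonglongrightarrow> measure lborel (\<Inter>n. {y. g y \<le> - real n} \<inter> ?B)"
      by (rule Lim_measure_decseq) (auto simp: decseq_def)
    moreover have "(\<Inter>n. {y. g y \<le> - real n} \<inter> ?B) = {}"
    proof -
      have "\<exists>n. \<not> g y \<le> - real n" for y
        using reals_Archimedean2[of "- g y"] by (auto simp: not_le minus_less_iff)
      then show ?thesis by auto
    qed
    ultimately show ?thesis by (simp add: w_def)
  qed
  define T where "T = {t. 2 * u t \<le> V}"
  obtain n' where "u (real n') < V / 2"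
    using order_tendstoD(2)[OF lim0, of "V / 2"] V by (auto simp: eventually_sequentially)
  then have "real n' \<in> T" by (simp add: T_def)
  then have "T \<noteq> {}" by auto
  obtain n where n: "w (- real n) < V / 2"
    using order_tendstoD(2)[OF limV, of "V / 2"] V by (auto simp: eventually_sequentially)
  have "bdd_below T"
  proof (rule bdd_belowI)
    fix t assume "t \<in> T"
    show "- real n \<le> t"
    proof (rule ccontr)
      assume "\<not> - real n \<le> t"
      then have "u (- real n) \<le> u t" by (intro anti) auto
      with n uw[of "- real n"] \<open>t \<in> T\<close> show False by (auto simp: T_def)
    qed
  qed
  define m where "m = Inf T"
  have above: "2 * u t \<le> V" if mt: "m < t" for t
  proof -
    obtain t' where "t' \<in> T" "t' < t"
      using cInf_lessD[OF \<open>T \<noteq> {}\<close>, of t] mt unfolding m_def by blast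
    then show ?thesis using anti[of t' t] by (auto simp: T_def)
  qed
  have below: "2 * w t \<le> V" if "t < m" for t
  proof -
    have "t \<notin> T" using that \<open>bdd_below T\<close> unfolding m_def by (meson cInf_lower not_le)
    then show ?thesis using uw[of t] by (auto simp: T_def)
  qed
  have rmono: "1 / real (Suc j) \<le> 1 / real (Suc i)" if "i \<le> j" for i j
    using that by (intro frac_le) auto
  show thesis
  proof (rule that)
    have "(\<lambda>n. u (m + 1 / real (Suc n))) \<longlonglongrightarrow> measure lborel (\<Union>n. {y. m + 1 / real (Suc n) < g y} \<inter> ?B)"
      unfolding u_def
    proof (rule Lim_measure_incseq)
      show "incseq (\<lambda>n. {y. m + 1 / real (Suc n) < g y} \<inter> ?B)"
        unfolding incseq_def
      proof (intro allI impI)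
        fix i j :: nat assume "i \<le> j"
        with rmono[OF this] show "{y. m + 1 / real (Suc i) < g y} \<inter> ?B \<subseteq> {y. m + 1 / real (Suc j) < g y} \<inter> ?B"
          by auto
      qed
      have "emeasure lborel (\<Union>n. {y. m + 1 / real (Suc n) < g y} \<inter> ?B) \<le> emeasure lborel ?B"
        by (intro emeasure_mono) auto
      then show "emeasure lborel (\<Union>n. {y. m + 1 / real (Suc n) < g y} \<inter> ?B) \<noteq> \<infinity>"
        using emeasure_ball_less_top[of z r] by (metis infinity_ennreal_def leD)
    qed auto
    moreover have "(\<Union>n. {y. m + 1 / real (Suc n) < g y} \<inter> ?B) = {y. m < g y} \<inter> ?B"
    proof -
      have "\<exists>n. m + 1 / real (Suc n) < g y" if "m < g y" for y
        using nat_approx_posE[of "g y - m"] that by (metis diff_gt_0_iff_gt less_diff_eq add.commute)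
      moreover have "m < g y" if "m + 1 / real (Suc n) < g y" for n y
        using that by (smt (verit) divide_pos_pos of_nat_0_less_iff zero_less_Suc)
      ultimately show ?thesis by blast
    qed
    ultimately have "(\<lambda>n. u (m + 1 / real (Suc n))) \<longlonglongrightarrow> measure lborel ({y. m < g y} \<inter> ?B)" by simp
    then have "measure lborel ({y. m < g y} \<inter> ?B) \<le> V / 2"
    proof (rule LIMSEQ_le_const2, intro exI allI impI)
      fix n :: nat
      show "u (m + 1 / real (Suc n)) \<le> V / 2"
        using above[of "m + 1 / real (Suc n)"] by simp
    qed
    then show "2 * measure lborel ({y. m < g y} \<inter> ?B) \<le> measure lborel ?B" by (simp add: V_def)
    have "(\<lambda>n. w (m - 1 / real (Suc n))) \<longlonglongrightarrow> measure lborel (\<Union>n. {y. g y \<le> m - 1 / real (Suc n)} \<inter> ?B)"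
      unfolding w_def
    proof (rule Lim_measure_incseq)
      show "incseq (\<lambda>n. {y. g y \<le> m - 1 / real (Suc n)} \<inter> ?B)"
        unfolding incseq_def
      proof (intro allI impI)
        fix i j :: nat assume "i \<le> j"
        with rmono[OF this] show "{y. g y \<le> m - 1 / real (Suc i)} \<inter> ?B \<subseteq> {y. g y \<le> m - 1 / real (Suc j)} \<inter> ?B"
          by auto
      qed
      have "emeasure lborel (\<Union>n. {y. g y \<le> m - 1 / real (Suc n)} \<inter> ?B) \<le> emeasure lborel ?B"
        by (intro emeasure_mono) auto
      then show "emeasure lborel (\<Union>n. {y. g y \<le> m - 1 / real (Suc n)} \<inter> ?B) \<noteq> \<infinity>"
        using emeasure_ball_less_top[of z r] by (metis infinity_ennreal_def leD)
    qed auto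
    moreover have "(\<Union>n. {y. g y \<le> m - 1 / real (Suc n)} \<inter> ?B) = {y. g y < m} \<inter> ?B"
    proof -
      have "\<exists>n. g y \<le> m - 1 / real (Suc n)" if "g y < m" for y
        using nat_approx_posE[of "m - g y"] that by (metis diff_gt_0_iff_gt less_diff_eq le_diff_eq add.commute less_imp_le)
      moreover have "g y < m" if "g y \<le> m - 1 / real (Suc n)" for n y
        using that by (smt (verit) divide_pos_pos of_nat_0_less_iff zero_less_Suc)
      ultimately show ?thesis by blast
    qed
    ultimately have "(\<lambda>n. w (m - 1 / real (Suc n))) \<longlonglongrightarrow> measure lborel ({y. g y < m} \<inter> ?B)" by simp
    then have "measure lborel ({y. g y < m} \<inter> ?B) \<le> V / 2"
    proof (rule LIMSEQ_le_const2, intro exI allI impI)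
      fix n :: nat
      show "w (m - 1 / real (Suc n)) \<le> V / 2"
        using below[of "m - 1 / real (Suc n)"] by simp
    qed
    then show "2 * measure lborel ({y. g y < m} \<inter> ?B) \<le> measure lborel ?B" by (simp add: V_def)
  qed
qed

text \<open>Chebyshev: where h <= t, the deviation |f - a| is at least b - t, and its mean over
  small balls drops below (b - t)/2, so h <= t on less than half of the ball. The one-sided
  hypothesis on h covers g, -g and both signs of g - m.\<close>

lemma eventually_half_dense_ball:
  fixes f h :: "'a::euclidean_space \<Rightarrow> real"
  assumes \<Omega>: "open \<Omega>" "x \<in> \<Omega>" and f: "set_integrable lebesgue \<Omega> f"
    and a: "has_Lebesgue_value f x a"
    and h [measurable]: "h \<in> borel_measurable borel"
    and le: "AE y in lebesgue. y \<in> \<Omega> \<longrightarrow> b - h y \<le> \<bar>f y - a\<bar>" and t: "t < b"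
  shows "\<forall>\<^sub>F k in sequentially. measure lborel (ball x (1 / Suc k)) < 2 * measure lborel ({y. t < h y} \<inter> ball x (1 / Suc k))"
proof -
  obtain e where e: "e > 0" "ball x e \<subseteq> \<Omega>" using \<Omega> open_contains_ball by blast
  have r0: "filterlim (\<lambda>k. 1 / real (Suc k)) (at_right 0) sequentially"
    using LIMSEQ_inverse_real_of_nat
    by (auto simp: filterlim_at inverse_eq_divide)
  have "\<forall>\<^sub>F r in at_right 0. 1 / measure lebesgue (ball x r) * (LINT y:ball x r|lebesgue. \<bar>f y - a\<bar>) < (b - t) / 2"
    by (rule order_tendstoD(2)[OF a[unfolded has_Lebesgue_value_def]]) (use t in simp)
  moreover have "\<forall>\<^sub>F r in at_right 0. 0 < r \<and> r < e"
    using e(1) by (auto simp: eventually_at_right_field)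
  ultimately have "\<forall>\<^sub>F r in at_right 0. measure lborel (ball x r) < 2 * measure lborel ({y. t < h y} \<inter> ball x r)"
  proof eventually_elim
    case (elim r)
    let ?B = "ball x r"
    have B\<Omega>: "?B \<subseteq> \<Omega>" using elim e by force
    have V: "0 < measure lebesgue ?B" using elim by simp
    have [simp]: "{y. h y \<le> t} \<in> sets borel" "{y. t < h y} \<in> sets borel" by measurable
    have int: "set_integrable lebesgue ?B (\<lambda>y. \<bar>f y - a\<bar>)"
    proof -
      have "set_integrable lebesgue ?B f"
        by (rule set_integrable_subset[OF f _ B\<Omega>]) simp
      moreover have "set_integrable lebesgue ?B (\<lambda>y. a)"
        unfolding set_integrable_def by (simp add: emeasure_completion)
      ultimately show ?thesis by (intro set_integrable_abs set_integral_diff)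
    qed
    have fin: "{y. h y \<le> t} \<inter> ?B \<in> fmeasurable lebesgue" "{y. t < h y} \<inter> ?B \<in> fmeasurable lebesgue"
      by (subst Int_commute, rule fmeasurable_Int_fmeasurable; simp)+
    have "(b - t) * measure lebesgue ({y. h y \<le> t} \<inter> ?B) = (\<integral>y. (b - t) * indicator ({y. h y \<le> t} \<inter> ?B) y \<partial>lebesgue)"
      by simp
    also have "\<dots> \<le> (LINT y:?B|lebesgue. \<bar>f y - a\<bar>)"
      unfolding set_lebesgue_integral_def
    proof (rule integral_mono_AE)
      show "integrable lebesgue (\<lambda>y. (b - t) * indicator ({y. h y \<le> t} \<inter> ?B) y)"
        using fin(1) by (intro integrable_mult_right integrable_real_indicator) (auto simp: fmeasurable_def)
      show "integrable lebesgue (\<lambda>y. indicat_real ?B y *\<^sub>R \<bar>f y - a\<bar>)"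
        using int by (simp add: set_integrable_def)
      show "AE y in lebesgue. (b - t) * indicator ({y. h y \<le> t} \<inter> ?B) y \<le> indicat_real ?B y *\<^sub>R \<bar>f y - a\<bar>"
        using le
      proof eventually_elim
        case (elim y)
        then show ?case using B\<Omega> by (cases "y \<in> ?B") (auto simp: indicator_def)
      qed
    qed
    also have "\<dots> < (b - t) / 2 * measure lebesgue ?B"
      using elim V by (simp add: field_simps)
    finally have "(b - t) * measure lebesgue ({y. h y \<le> t} \<inter> ?B) < (b - t) * (measure lebesgue ?B / 2)" by simp
    then have "2 * measure lebesgue ({y. h y \<le> t} \<inter> ?B) < measure lebesgue ?B"
      using t by (subst (asm) mult_less_cancel_left_pos) auto
    moreover have "measure lebesgue (({y. t < h y} \<inter> ?B) \<union> ({y. h y \<le> t} \<inter> ?B))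
        = measure lebesgue ({y. t < h y} \<inter> ?B) + measure lebesgue ({y. h y \<le> t} \<inter> ?B)"
      using fin by (intro measure_Union) (auto simp: fmeasurable_def)
    moreover have "({y. t < h y} \<inter> ?B) \<union> ({y. h y \<le> t} \<inter> ?B) = ?B" by auto
    ultimately have "measure lebesgue ?B < 2 * measure lebesgue ({y. t < h y} \<inter> ?B)" by simp
    then show ?case by (simp add: measure_completion sets.Int)
  qed
  from eventually_compose_filterlim[OF this r0] show ?thesis .
qed

lemma half_dense_of_Lebesgue_value:
  fixes f h :: "'a::euclidean_space \<Rightarrow> real"
  assumes "open \<Omega>" "x \<in> \<Omega>" "set_integrable lebesgue \<Omega> f"
    and "has_Lebesgue_value f x a" "h \<in> borel_measurable borel"
    and "AE y in lebesgue. y \<in> \<Omega> \<longrightarrow> b - h y \<le> \<bar>f y - a\<bar>" "t < b"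
  shows "x \<in> half_dense {y. t < h y}"
  using eventually_frequently[OF _ eventually_half_dense_ball[OF assms]] by (simp add: half_dense_def)

text \<open>If b < t < a, the disjoint sets where g > t and g < t would each fill more than half of
  a small ball. Exchanging a and b gives uniqueness, hence the meaning of
  \<open>precise_rep\<close>.\<close>

lemma has_Lebesgue_value_le:
  fixes f g :: "'a::euclidean_space \<Rightarrow> real"
  assumes \<Omega>: "open \<Omega>" "x \<in> \<Omega>" and f: "set_integrable lebesgue \<Omega> f"
    and g [measurable]: "g \<in> borel_measurable borel" and fg: "AE y in lebesgue. y \<in> \<Omega> \<longrightarrow> f y = g y"
    and a: "has_Lebesgue_value f x a" and b: "has_Lebesgue_value f x b"
  shows "a \<le> b"
proof (rule ccontr)
  assume "\<not> a \<le> b"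
  then obtain t where t: "b < t" "t < a" using dense by (auto simp: not_le)
  have "\<forall>\<^sub>F k in sequentially. measure lborel (ball x (1 / Suc k)) < 2 * measure lborel ({y. t < g y} \<inter> ball x (1 / Suc k))"
    by (rule eventually_half_dense_ball[OF \<Omega> f a g _ t(2)]) (use fg in eventually_elim, auto)
  moreover have "\<forall>\<^sub>F k in sequentially. measure lborel (ball x (1 / Suc k)) < 2 * measure lborel ({y. - t < - g y} \<inter> ball x (1 / Suc k))"
    by (rule eventually_half_dense_ball[OF \<Omega> f b, where b = "- b"]) (measurable, use fg in eventually_elim, use t in auto)
  ultimately have "\<forall>\<^sub>F k::nat in sequentially. False"
  proof eventually_elim
    case (elim k)
    let ?B = "ball x (1 / real (Suc k))"
    have [simp]: "{y. t < g y} \<in> sets borel" "{y. g y < t} \<in> sets borel" by measurable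
    have fin: "{y. t < g y} \<inter> ?B \<in> fmeasurable lborel" "{y. g y < t} \<inter> ?B \<in> fmeasurable lborel"
      by (subst Int_commute, rule fmeasurable_Int_fmeasurable; simp)+
    have "measure lborel ({y. t < g y} \<inter> ?B) + measure lborel ({y. g y < t} \<inter> ?B)
        = measure lborel (({y. t < g y} \<inter> ?B) \<union> ({y. g y < t} \<inter> ?B))"
      using fin by (intro measure_Union[symmetric]) (auto simp: fmeasurable_def)
    also have "\<dots> \<le> measure lborel ?B"
      by (intro measure_mono_fmeasurable) auto
    finally show ?case using elim by simp
  qed
  then show False by simp
qed

lemma precise_rep_eq:
  fixes f g :: "'a::euclidean_space \<Rightarrow> real"
  assumes "open \<Omega>" "x \<in> \<Omega>" "set_integrable lebesgue \<Omega> f"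
    "g \<in> borel_measurable borel" "AE y in lebesgue. y \<in> \<Omega> \<longrightarrow> f y = g y"
    and "has_Lebesgue_value f x a"
  shows "precise_rep f x = a"
  unfolding precise_rep_def
  using has_Lebesgue_value_le[OF assms(1-5)] assms(6) by (intro the_equality antisym) auto

section \<open>The trace inequality\<close>

context John_domain
begin

section \<open>The final constant, and the size of a John domain in terms of its diameter\<close>

definition \<Lambda> :: real where "\<Lambda> = max 1 (10 * D)"

text \<open>16 = 2 * 2 * 4: splitting at the median, two signs, dyadic levels. The fraction pays for
  replacing the median by the mean: one \<open>\<Lambda> ^ DIM('a)\<close> from the growth of
  Lebesgue measure, one from the measure of Omega, over the lower bound for the volume of Omega; the
  unit ball volumes cancel.\<close>

definition trace_const :: "real \<Rightarrow> real" where
  "trace_const C\<^sub>\<mu> = 16 * C\<^sub>\<mu> * \<kappa> * (1 + \<Lambda> ^ DIM('a) * \<Lambda> ^ DIM('a) / ((D / 2) powr s / C\<^sub>J) ^ DIM('a))"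

lemma trace_const_pos: "0 < C\<^sub>\<mu> \<Longrightarrow> 0 < trace_const C\<^sub>\<mu>"
  unfolding trace_const_def using \<kappa>_pos C\<^sub>J_ge_1 D_pos
  by (intro mult_pos_pos add_pos_nonneg divide_nonneg_nonneg mult_nonneg_nonneg zero_le_power) (auto simp: \<Lambda>_def)

lemma \<Lambda>_powr_le:
  assumes "0 \<le> a" "a \<le> real DIM('a)"
  shows "\<Lambda> powr a \<le> \<Lambda> ^ DIM('a)"
proof -
  have "\<Lambda> powr a \<le> \<Lambda> powr real DIM('a)" using assms by (intro powr_mono) (auto simp: \<Lambda>_def)
  also have "\<dots> = \<Lambda> ^ DIM('a)" by (simp add: powr_realpow \<Lambda>_def)
  finally show ?thesis .
qed

lemma \<beta>_nonneg: "0 \<le> s * (real DIM('a) - \<delta>)"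
  using s_ge_1 exponent_pos by simp

text \<open>The excess exponent n - s(n - delta) lies between 0 and n, so on the bounded range of
  radii the excess power of r is at most \<open>\<Lambda> ^ DIM('a)\<close>. The factor 1 in the
  exponent is q = 1.\<close>

lemma lborel_ball_growth:
  fixes x :: 'a
  assumes "0 < r" "r \<le> 10 * D"
  shows "emeasure lborel (ball x r) \<le> ennreal (unit_ball_vol (real DIM('a)) * \<Lambda> ^ DIM('a) * r powr (1 * (s * (real DIM('a) - \<delta>))))"
proof -
  let ?\<beta> = "s * (real DIM('a) - \<delta>)"
  have "r ^ DIM('a) = r powr (real DIM('a) - ?\<beta>) * r powr ?\<beta>"
    using assms by (simp add: powr_realpow flip: powr_add)
  also have "r powr (real DIM('a) - ?\<beta>) \<le> \<Lambda> powr (real DIM('a) - ?\<beta>)"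
    using assms s_le by (intro powr_mono2) (auto simp: \<Lambda>_def)
  also have "\<dots> \<le> \<Lambda> ^ DIM('a)"
    using s_le \<beta>_nonneg by (intro \<Lambda>_powr_le) auto
  finally have "r ^ DIM('a) \<le> \<Lambda> ^ DIM('a) * r powr ?\<beta>" by (simp add: mult_right_mono)
  then have "unit_ball_vol (real DIM('a)) * r ^ DIM('a) \<le> unit_ball_vol (real DIM('a)) * (\<Lambda> ^ DIM('a) * r powr ?\<beta>)"
    by (intro mult_left_mono) auto
  then show ?thesis
    using assms by (simp add: emeasure_ball ennreal_leI mult.assoc)
qed

text \<open>The John condition at the endpoint of each curve places all of Omega near the center, at
  a distance governed by d at the center. Read backwards, a given diameter forces a ball of definite
  size inside Omega.\<close>

lemma half_D_powr_le: "(D / 2) powr s / C\<^sub>J \<le> d x\<^sub>J"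
proof -
  have C0: "0 < C\<^sub>J" using C\<^sub>J_ge_1 by simp
  have *: "dist x x\<^sub>J \<le> (C\<^sub>J * d x\<^sub>J) powr (1 / s)" if x: "x \<in> \<Omega>" for x
  proof -
    obtain \<gamma> where \<gamma>: "pathfinish \<gamma> = x\<^sub>J"
      and d\<gamma>: "\<And>t. t \<in> {0..1} \<Longrightarrow> C\<^sub>J * d (\<gamma> t) > norm (\<gamma> t - x) powr s"
      using John x unfolding distance_John_domain_def by meson
    have "norm (x\<^sub>J - x) powr s \<le> C\<^sub>J * d x\<^sub>J"
      using d\<gamma>[of 1] \<gamma> by (simp add: pathfinish_def)
    then have "(norm (x\<^sub>J - x) powr s) powr (1 / s) \<le> (C\<^sub>J * d x\<^sub>J) powr (1 / s)"
      using s_ge_1 by (intro powr_mono2) auto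
    then show ?thesis using s_ge_1 by (simp add: powr_powr dist_norm norm_minus_commute)
  qed
  have "diameter \<Omega> \<le> 2 * (C\<^sub>J * d x\<^sub>J) powr (1 / s)"
  proof (rule diameter_le)
    fix x y assume "x \<in> \<Omega>" "y \<in> \<Omega>"
    then show "norm (x - y) \<le> 2 * (C\<^sub>J * d x\<^sub>J) powr (1 / s)"
      using *[of x] *[of y] dist_triangle2[of x y x\<^sub>J] by (simp add: dist_norm)
  qed auto
  then have "D / 2 \<le> (C\<^sub>J * d x\<^sub>J) powr (1 / s)" using diam by simp
  then have "(D / 2) powr s \<le> ((C\<^sub>J * d x\<^sub>J) powr (1 / s)) powr s"
    using D_pos s_ge_1 by (intro powr_mono2) auto
  also have "\<dots> = C\<^sub>J * d x\<^sub>J"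
    using s_ge_1 bdist_pos[OF center] C0 by (simp add: powr_powr)
  finally show ?thesis using C0 by (simp add: pos_divide_le_eq mult.commute)
qed

lemma volume_bound_pos: "0 < unit_ball_vol (real DIM('a)) * ((D / 2) powr s / C\<^sub>J) ^ DIM('a)"
proof -
  have "0 < C\<^sub>J" using C\<^sub>J_ge_1 by simp
  then show ?thesis
    using D_pos by (intro mult_pos_pos zero_less_power divide_pos_pos unit_ball_vol_pos) auto
qed

lemma measure_\<Omega>_ge:
  "unit_ball_vol (real DIM('a)) * ((D / 2) powr s / C\<^sub>J) ^ DIM('a) \<le> measure lebesgue \<Omega>"
proof -
  have "unit_ball_vol (real DIM('a)) * ((D / 2) powr s / C\<^sub>J) ^ DIM('a) \<le> unit_ball_vol (real DIM('a)) * d x\<^sub>J ^ DIM('a)"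
    using half_D_powr_le D_pos C\<^sub>J_ge_1 by (intro mult_left_mono power_mono) auto
  also have "\<dots> = measure lebesgue (ball x\<^sub>J (d x\<^sub>J))"
    using bdist_pos[OF center] by (simp add: content_ball)
  also have "\<dots> \<le> measure lebesgue \<Omega>"
    using ball_bdist_subset[OF center] open_\<Omega> bounded_\<Omega>
    by (intro measure_mono_fmeasurable) (auto intro: lmeasurable_open)
  finally show ?thesis .
qed

text \<open>f is only Lebesgue measurable. Passing to a Borel representative affects the inner
  integrand on a null set of x and the inner integral on a null set of y.\<close>

lemma John_energy_eq:
  assumes fg: "AE y in lborel. y \<in> \<Omega> \<longrightarrow> f y = g y"
  shows "(\<integral>\<^sup>+y\<in>\<Omega>. (\<integral>\<^sup>+x\<in>{x\<in>\<Omega>. norm (x - y) < \<tau> * d y}.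
       ennreal (\<bar>f x - f y\<bar> / norm (x - y) powr (real DIM('a) + \<delta>)) \<partial>lebesgue) \<partial>lebesgue)
     = John_energy \<tau> \<delta> \<Omega> g"
  unfolding nn_integral_completion John_energy_def
proof (rule nn_integral_cong_AE)
  show "AE y in lborel. (\<integral>\<^sup>+x\<in>{x\<in>\<Omega>. norm (x - y) < \<tau> * d y}.
       ennreal (\<bar>f x - f y\<bar> / norm (x - y) powr (real DIM('a) + \<delta>)) \<partial>lborel) * indicator \<Omega> y
     = (\<integral>\<^sup>+x. John_kernel \<tau> \<delta> \<Omega> x y * ennreal \<bar>g x - g y\<bar> \<partial>lborel)"
    using fg
  proof eventually_elim
    case y: (elim y)
    show ?case
    proof (cases "y \<in> \<Omega>")
      case True
      have "(\<integral>\<^sup>+x\<in>{x\<in>\<Omega>. norm (x - y) < \<tau> * d y}.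
          ennreal (\<bar>f x - f y\<bar> / norm (x - y) powr (real DIM('a) + \<delta>)) \<partial>lborel)
        = (\<integral>\<^sup>+x. John_kernel \<tau> \<delta> \<Omega> x y * ennreal \<bar>g x - g y\<bar> \<partial>lborel)"
      proof (rule nn_integral_cong_AE)
        show "AE x in lborel. ennreal (\<bar>f x - f y\<bar> / norm (x - y) powr (real DIM('a) + \<delta>)) *
            indicator {x\<in>\<Omega>. norm (x - y) < \<tau> * d y} x = John_kernel \<tau> \<delta> \<Omega> x y * ennreal \<bar>g x - g y\<bar>"
          using fg
          by eventually_elim (use y True in \<open>auto simp: John_kernel_def ennreal_mult[symmetric]\<close>)
      qed
      then show ?thesis using True by simp
    qed (simp add: John_kernel_def)
  qed
qed

text \<open>The median is fixed before the measure, its constant and q, because the same m is used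
  for \<open>\<mu>\<close> and for Lebesgue measure with q = 1.\<close>

lemma median_split:
  assumes g [measurable]: "g \<in> borel_measurable borel" and p: "0 \<le> p" "John_energy \<tau> \<delta> \<Omega> g \<le> ennreal p"
  obtains m where
    "\<And>\<mu> C\<^sub>\<mu> q. \<lbrakk>sets \<mu> = sets borel; 0 < C\<^sub>\<mu>; 1 \<le> q;
      \<And>x r. 0 < r \<Longrightarrow> r \<le> 10 * D \<Longrightarrow> emeasure \<mu> (ball x r) \<le> ennreal (C\<^sub>\<mu> * r powr (q * (s * (DIM('a) - \<delta>))))\<rbrakk>
      \<Longrightarrow> (\<integral>\<^sup>+x. level_sum q (\<lambda>y. g y - m) x + level_sum q (\<lambda>y. m - g y) x \<partial>\<mu>)
        \<le> ennreal (2 * (C\<^sub>\<mu> * (4 * \<kappa> * (1 - \<delta>) * p) powr q))"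
proof -
  have "0 < \<tau> / 4 * d x\<^sub>J" using \<tau> bdist_pos[OF center] by simp
  then obtain m where m: "2 * measure lborel ({y. m < g y} \<inter> B\<^sub>J) \<le> measure lborel B\<^sub>J"
    "2 * measure lborel ({y. g y < m} \<inter> B\<^sub>J) \<le> measure lborel B\<^sub>J"
    using exists_median[OF g, where z = x\<^sub>J] by blast
  show thesis
  proof (rule that)
    fix \<mu> :: "'a measure" and C\<^sub>\<mu> q :: real
    assume \<mu>: "sets \<mu> = sets borel" "0 < C\<^sub>\<mu>" "1 \<le> q"
      "\<And>x r. 0 < r \<Longrightarrow> r \<le> 10 * D \<Longrightarrow> emeasure \<mu> (ball x r) \<le> ennreal (C\<^sub>\<mu> * r powr (q * (s * (DIM('a) - \<delta>))))"
    note [measurable_cong] = \<mu>(1)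
    have "(\<integral>\<^sup>+x. level_sum q (\<lambda>y. g y - m) x + level_sum q (\<lambda>y. m - g y) x \<partial>\<mu>)
      = (\<integral>\<^sup>+x. level_sum q (\<lambda>y. g y - m) x \<partial>\<mu>) + (\<integral>\<^sup>+x. level_sum q (\<lambda>y. m - g y) x \<partial>\<mu>)"
      by (rule nn_integral_add) measurable
    also have "\<dots> \<le> ennreal (C\<^sub>\<mu> * (4 * \<kappa> * (1 - \<delta>) * p) powr q) + ennreal (C\<^sub>\<mu> * (4 * \<kappa> * (1 - \<delta>) * p) powr q)"
    proof (intro add_mono nn_integral_level_sum_le \<mu> p(1))
      show "John_energy \<tau> \<delta> \<Omega> (\<lambda>y. g y - m) \<le> ennreal p" "John_energy \<tau> \<delta> \<Omega> (\<lambda>y. m - g y) \<le> ennreal p"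
        using p(2) by (simp_all add: John_energy_def abs_minus_commute)
    qed (use m in auto)
    also have "\<dots> = ennreal (2 * (C\<^sub>\<mu> * (4 * \<kappa> * (1 - \<delta>) * p) powr q))"
      using \<mu>(2) by (simp add: ennreal_plus[symmetric] del: ennreal_plus)
    finally show "(\<integral>\<^sup>+x. level_sum q (\<lambda>y. g y - m) x + level_sum q (\<lambda>y. m - g y) x \<partial>\<mu>)
        \<le> ennreal (2 * (C\<^sub>\<mu> * (4 * \<kappa> * (1 - \<delta>) * p) powr q))" .
  qed
qed

lemma abs_powr_le_level_sum:
  assumes "0 < q" "x \<in> \<Omega>"
    and "\<And>t. t < u \<Longrightarrow> x \<in> half_dense {y. t < h y}" "\<And>t. t < - u \<Longrightarrow> x \<in> half_dense {y. t < h' y}"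
  shows "ennreal (\<bar>u\<bar> powr q) \<le> level_sum q h x + level_sum q h' x"
proof (cases "0 \<le> u")
  case True
  then have "ennreal (\<bar>u\<bar> powr q) = ennreal (max 0 u powr q)" by simp
  also have "\<dots> \<le> level_sum q h x" using assms by (intro powr_le_level_sum) auto
  finally show ?thesis by (simp add: add_increasing2)
next
  case False
  then have "ennreal (\<bar>u\<bar> powr q) = ennreal (max 0 (- u) powr q)" by simp
  also have "\<dots> \<le> level_sum q h' x" using assms by (intro powr_le_level_sum) auto
  finally show ?thesis by (simp add: add_increasing)
qed

text \<open>Null sets are discarded for rational levels only; a rational level fits between t and h
  x, and \<open>half_dense\<close> is monotone.\<close>

lemma AE_half_dense_levels:
  fixes h :: "'a \<Rightarrow> real"
  assumes [measurable]: "h \<in> borel_measurable borel"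
  shows "AE x in lborel. \<forall>t<h x. x \<in> half_dense {y. t < h y}"
proof -
  have "AE x in lborel. \<forall>t\<in>\<rat>. x \<in> {y. t < h y} \<longrightarrow> x \<in> half_dense {y. t < h y}"
    by (subst AE_ball_countable[OF countable_rat]) (intro ballI AE_half_dense, measurable)
  then show ?thesis
  proof eventually_elim
    case (elim x)
    show ?case
    proof (intro allI impI)
      fix t assume "t < h x"
      then obtain t' where t': "t' \<in> \<rat>" "t < t'" "t' < h x" using Rats_dense_in_real by blast
      then have "{y. t' < h y} \<subseteq> {y. t < h y}" by auto
      then have "half_dense {y. t' < h y} \<subseteq> half_dense {y. t < h y}"
        by (rule half_dense_mono) measurable
      then show "x \<in> half_dense {y. t < h y}" using elim t' by auto
    qed
  qed
qed

text \<open>The left side is at most the integral of |f - m| over Omega, and the level sums with q =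
  1 dominate |f - m| almost everywhere.\<close>

lemma mean_minus_median_le:
  assumes f: "set_integrable lebesgue \<Omega> f"
    and g [measurable]: "g \<in> borel_measurable borel" and fg: "AE y in lborel. y \<in> \<Omega> \<longrightarrow> f y = g y"
    and X: "0 \<le> X" "(\<integral>\<^sup>+x. level_sum 1 (\<lambda>y. g y - m) x + level_sum 1 (\<lambda>y. m - g y) x \<partial>lborel) \<le> ennreal X"
  shows "measure lebesgue \<Omega> * \<bar>m - mean_on \<Omega> f\<bar> \<le> X"
proof -
  have \<Omega>_fm: "\<Omega> \<in> lmeasurable" using bounded_\<Omega> open_\<Omega> by (rule lmeasurable_open)
  have V: "0 < measure lebesgue \<Omega>"
    using measure_\<Omega>_ge volume_bound_pos by linarith
  have const: "set_integrable lebesgue \<Omega> (\<lambda>x. m)"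
    using \<Omega>_fm unfolding set_integrable_def by (auto simp: fmeasurable_def)
  have int: "set_integrable lebesgue \<Omega> (\<lambda>x. f x - m)"
    by (intro set_integral_diff f const)
  have "measure lebesgue \<Omega> * (mean_on \<Omega> f - m) = (LINT x:\<Omega>|lebesgue. f x) - (LINT x:\<Omega>|lebesgue. m)"
    using V \<Omega>_fm by (simp add: mean_on_def right_diff_distrib set_lebesgue_integral_def mult.commute)
  also have "\<dots> = (LINT x:\<Omega>|lebesgue. f x - m)"
    by (rule set_integral_diff(2)[OF f const, symmetric])
  finally have "measure lebesgue \<Omega> * \<bar>m - mean_on \<Omega> f\<bar> = \<bar>LINT x:\<Omega>|lebesgue. f x - m\<bar>"
    using V by (metis abs_minus_commute abs_mult abs_of_pos)
  also have "\<dots> \<le> (LINT x:\<Omega>|lebesgue. \<bar>f x - m\<bar>)"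
    using set_integral_norm_bound[OF int] by simp
  finally have "ennreal (measure lebesgue \<Omega> * \<bar>m - mean_on \<Omega> f\<bar>) \<le> ennreal (LINT x:\<Omega>|lebesgue. \<bar>f x - m\<bar>)"
    by (rule ennreal_leI)
  also have "\<dots> = (\<integral>\<^sup>+x. ennreal (indicator \<Omega> x *\<^sub>R \<bar>f x - m\<bar>) \<partial>lebesgue)"
    unfolding set_lebesgue_integral_def
    using set_integrable_abs[OF int] by (intro nn_integral_eq_integral[symmetric]) (auto simp: set_integrable_def)
  also have "\<dots> = (\<integral>\<^sup>+x. ennreal (indicator \<Omega> x *\<^sub>R \<bar>f x - m\<bar>) \<partial>lborel)"
    by (rule nn_integral_completion)
  also have "\<dots> \<le> (\<integral>\<^sup>+x. level_sum 1 (\<lambda>y. g y - m) x + level_sum 1 (\<lambda>y. m - g y) x \<partial>lborel)"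
  proof (rule nn_integral_mono_AE)
    have "AE x in lborel. \<forall>t<g x - m. x \<in> half_dense {y. t < g y - m}"
      "AE x in lborel. \<forall>t<m - g x. x \<in> half_dense {y. t < m - g y}"
      by (intro AE_half_dense_levels; measurable)+
    then show "AE x in lborel. ennreal (indicator \<Omega> x *\<^sub>R \<bar>f x - m\<bar>)
        \<le> level_sum 1 (\<lambda>y. g y - m) x + level_sum 1 (\<lambda>y. m - g y) x"
      using fg
    proof eventually_elim
      case (elim x)
      show ?case
      proof (cases "x \<in> \<Omega>")
        case True
        then have "ennreal (indicator \<Omega> x *\<^sub>R \<bar>f x - m\<bar>) = ennreal (\<bar>g x - m\<bar> powr 1)"
          using elim by simp
        also have "\<dots> \<le> level_sum 1 (\<lambda>y. g y - m) x + level_sum 1 (\<lambda>y. m - g y) x"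
          using elim True by (intro abs_powr_le_level_sum) auto
        finally show ?thesis .
      qed simp
    qed
  qed
  also note X(2)
  finally show ?thesis using X(1) by simp
qed

theorem trace_inequality:
  assumes sets_\<mu>: "sets \<mu> = sets borel" and C\<^sub>\<mu>: "1 \<le> C\<^sub>\<mu>" and q: "1 \<le> q"
    and growth: "\<And>x r. 0 < r \<Longrightarrow> emeasure \<mu> (ball x r) \<le> ennreal (C\<^sub>\<mu> * r powr (q * (s * (DIM('a) - \<delta>))))"
    and f: "set_integrable lebesgue \<Omega> f"
  shows "ennreal_powr (\<integral>\<^sup>+x\<in>Lebesgue_points \<Omega> f. ennreal (\<bar>precise_rep f x - mean_on \<Omega> f\<bar> powr q) \<partial>\<mu>) (1 / q)
    \<le> ennreal (trace_const C\<^sub>\<mu> * (1 - \<delta>)) *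
      (\<integral>\<^sup>+y\<in>\<Omega>. (\<integral>\<^sup>+x\<in>{x\<in>\<Omega>. norm (x - y) < \<tau> * d y}.
         ennreal (\<bar>f x - f y\<bar> / norm (x - y) powr (real DIM('a) + \<delta>)) \<partial>lebesgue) \<partial>lebesgue)"
proof -
  have "(\<lambda>x. indicat_real \<Omega> x *\<^sub>R f x) \<in> borel_measurable lebesgue"
    using f by (simp add: set_integrable_def borel_measurable_integrable)
  from completion_ex_borel_measurable_real[OF this] obtain g
    where "g \<in> borel_measurable lborel" and g_eq: "AE x in lborel. indicat_real \<Omega> x *\<^sub>R f x = g x"
    by blast
  then have g [measurable]: "g \<in> borel_measurable borel" by simp
  from g_eq have fg: "AE x in lborel. x \<in> \<Omega> \<longrightarrow> f x = g x"
    by (elim eventually_mono) (auto simp: indicator_def split: if_splits)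
  then have fg': "AE x in lebesgue. x \<in> \<Omega> \<longrightarrow> f x = g x"
    by (rule AE_completion)
  show ?thesis
  proof (cases "John_energy \<tau> \<delta> \<Omega> g = \<infinity>")
    case True
    \<comment> \<open>Strict positivity, and with it delta < 1, matters: in \<open>ennreal\<close>
      the product \<open>0 * \<infinity>\<close> is 0.\<close>
    have "0 < trace_const C\<^sub>\<mu> * (1 - \<delta>)" using trace_const_pos[of C\<^sub>\<mu>] C\<^sub>\<mu> \<delta> by simp
    then have "ennreal (trace_const C\<^sub>\<mu> * (1 - \<delta>)) * \<infinity> = \<infinity>"
      unfolding ennreal_mult_eq_top_iff infinity_ennreal_def by (auto simp only: ennreal_eq_0_iff)
    then show ?thesis
      unfolding John_energy_eq[OF fg] True by (simp only: infinity_ennreal_def top_greatest)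
  next
    case False
    define p where "p = enn2real (John_energy \<tau> \<delta> \<Omega> g)"
    have p: "0 \<le> p" "John_energy \<tau> \<delta> \<Omega> g = ennreal p"
      using False by (simp_all add: p_def less_top)
    let ?v = "unit_ball_vol (real DIM('a))"
    define L where "L = \<Lambda> ^ DIM('a)"
    define \<rho> where "\<rho> = ((D / 2) powr s / C\<^sub>J) ^ DIM('a)"
    define Z where "Z = \<kappa> * (1 - \<delta>) * p"
    have Z: "0 \<le> Z" using \<kappa>_pos \<delta> p by (simp add: Z_def)
    have L: "1 \<le> L" unfolding L_def \<Lambda>_def by (intro one_le_power) simp
    have v: "0 < ?v" by (intro unit_ball_vol_pos) simp
    have \<rho>: "0 < \<rho>" using volume_bound_pos v unfolding \<rho>_def by (simp add: zero_less_mult_iff)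
    obtain m where m: "\<And>\<mu> C\<^sub>\<mu> q. \<lbrakk>sets \<mu> = sets borel; 0 < C\<^sub>\<mu>; 1 \<le> q;
      \<And>x r. 0 < r \<Longrightarrow> r \<le> 10 * D \<Longrightarrow> emeasure \<mu> (ball x r) \<le> ennreal (C\<^sub>\<mu> * r powr (q * (s * (DIM('a) - \<delta>))))\<rbrakk>
      \<Longrightarrow> (\<integral>\<^sup>+x. level_sum q (\<lambda>y. g y - m) x + level_sum q (\<lambda>y. m - g y) x \<partial>\<mu>)
        \<le> ennreal (2 * (C\<^sub>\<mu> * (4 * \<kappa> * (1 - \<delta>) * p) powr q))"
      using median_split[OF g p(1) order.eq_iff[THEN iffD1, THEN conjunct1, OF p(2)]] by blast
    let ?G = "\<lambda>x. level_sum q (\<lambda>y. g y - m) x + level_sum q (\<lambda>y. m - g y) x"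
    have "(\<integral>\<^sup>+x. level_sum 1 (\<lambda>y. g y - m) x + level_sum 1 (\<lambda>y. m - g y) x \<partial>lborel)
        \<le> ennreal (2 * (?v * L * (4 * \<kappa> * (1 - \<delta>) * p) powr 1))"
      unfolding L_def
      by (rule m) (use v L lborel_ball_growth in \<open>auto simp: L_def\<close>)
    also have "2 * (?v * L * (4 * \<kappa> * (1 - \<delta>) * p) powr 1) = 8 * ?v * L * Z"
      using \<kappa>_pos \<delta> p(1) by (simp add: Z_def)
    finally have "measure lebesgue \<Omega> * \<bar>m - mean_on \<Omega> f\<bar> \<le> 8 * ?v * L * Z"
      using L v Z by (intro mean_minus_median_le[OF f g fg]) auto
    moreover have "?v * \<rho> * \<bar>m - mean_on \<Omega> f\<bar> \<le> measure lebesgue \<Omega> * \<bar>m - mean_on \<Omega> f\<bar>"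
      using measure_\<Omega>_ge unfolding \<rho>_def by (rule mult_right_mono) simp
    ultimately have "?v * \<rho> * \<bar>m - mean_on \<Omega> f\<bar> \<le> 8 * ?v * L * Z" by linarith
    then have "?v * (\<rho> * \<bar>m - mean_on \<Omega> f\<bar>) \<le> ?v * (8 * L * Z)" by (simp only: mult_ac)
    then have "\<rho> * \<bar>m - mean_on \<Omega> f\<bar> \<le> 8 * L * Z" unfolding mult_le_cancel_left_pos[OF v] .
    then have mean: "\<bar>m - mean_on \<Omega> f\<bar> \<le> 8 * L * Z / \<rho>"
      using \<rho> by (simp add: pos_le_divide_eq mult.commute)
    have integral: "(\<integral>\<^sup>+x. ?G x \<partial>\<mu>) \<le> ennreal (2 * (C\<^sub>\<mu> * (4 * Z) powr q))"
      using m[OF sets_\<mu> _ q growth] C\<^sub>\<mu> by (simp add: Z_def mult.assoc)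
    define R where "R = (8 * L * Z / \<rho>) powr q"
    have pw: "ennreal (\<bar>precise_rep f x - mean_on \<Omega> f\<bar> powr q) * indicator (Lebesgue_points \<Omega> f) x
        \<le> ennreal (2 powr q) * (?G x + ennreal R * indicator \<Omega> x)" for x
    proof (cases "x \<in> Lebesgue_points \<Omega> f")
      case True
      then obtain a where x: "x \<in> \<Omega>" and a: "has_Lebesgue_value f x a"
        by (auto simp: Lebesgue_points_def)
      have rep: "precise_rep f x = a"
        by (rule precise_rep_eq[OF open_\<Omega> x f g fg' a])
      have "\<bar>a - mean_on \<Omega> f\<bar> \<le> \<bar>a - m\<bar> + \<bar>m - mean_on \<Omega> f\<bar>"
        using abs_triangle_ineq[of "a - m" "m - mean_on \<Omega> f"] by simp
      also have "\<dots> \<le> max \<bar>a - m\<bar> \<bar>m - mean_on \<Omega> f\<bar> + max \<bar>a - m\<bar> \<bar>m - mean_on \<Omega> f\<bar>"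
        by (intro add_mono) simp_all
      finally have "\<bar>a - mean_on \<Omega> f\<bar> \<le> 2 * max \<bar>a - m\<bar> \<bar>m - mean_on \<Omega> f\<bar>"
        by simp
      then have "\<bar>a - mean_on \<Omega> f\<bar> powr q \<le> (2 * max \<bar>a - m\<bar> \<bar>m - mean_on \<Omega> f\<bar>) powr q"
        using q by (intro powr_mono2) auto
      also have "\<dots> = 2 powr q * max \<bar>a - m\<bar> \<bar>m - mean_on \<Omega> f\<bar> powr q"
        by (simp add: powr_mult)
      also have "max \<bar>a - m\<bar> \<bar>m - mean_on \<Omega> f\<bar> powr q \<le> \<bar>a - m\<bar> powr q + \<bar>m - mean_on \<Omega> f\<bar> powr q"
        by (simp add: max_def)
      also have "\<bar>m - mean_on \<Omega> f\<bar> powr q \<le> R"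
        unfolding R_def using q mean by (intro powr_mono2) auto
      finally have "ennreal (\<bar>a - mean_on \<Omega> f\<bar> powr q) \<le> ennreal (2 powr q * (\<bar>a - m\<bar> powr q + R))"
        by (intro ennreal_leI) simp
      also have "\<dots> = ennreal (2 powr q) * (ennreal (\<bar>a - m\<bar> powr q) + ennreal R)"
        by (simp add: ennreal_mult R_def)
      also have "ennreal (\<bar>a - m\<bar> powr q) \<le> ?G x"
      proof (rule abs_powr_le_level_sum)
        \<comment> \<open>For h = g - m the value is b = a - m, for h = m - g it is b = m - a; in
          both cases b - h is plus or minus a - g.\<close>
        show "x \<in> half_dense {y. t < g y - m}" if "t < a - m" for t
          by (rule half_dense_of_Lebesgue_value[OF open_\<Omega> x f a _ _ that])
             (measurable, use fg' in eventually_elim, auto)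
        show "x \<in> half_dense {y. t < m - g y}" if "t < - (a - m)" for t
          by (rule half_dense_of_Lebesgue_value[OF open_\<Omega> x f a _ _ that])
             (measurable, use fg' in eventually_elim, auto)
      qed (use q x in auto)
      finally show ?thesis using True x rep by (simp add: mult_left_mono add_right_mono)
    qed simp
    note [measurable_cong] = sets_\<mu>
    have "(\<integral>\<^sup>+x\<in>Lebesgue_points \<Omega> f. ennreal (\<bar>precise_rep f x - mean_on \<Omega> f\<bar> powr q) \<partial>\<mu>)
        \<le> (\<integral>\<^sup>+x. ennreal (2 powr q) * (?G x + ennreal R * indicator \<Omega> x) \<partial>\<mu>)"
      \<comment> \<open>Monotonicity holds without measurability, so the precise representative need
        not be examined under \<open>\<mu>\<close>.\<close>
      by (intro nn_integral_mono pw)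
    also have "\<dots> = ennreal (2 powr q) * ((\<integral>\<^sup>+x. ?G x \<partial>\<mu>) + ennreal R * emeasure \<mu> \<Omega>)"
      by (subst nn_integral_cmult, measurable, subst nn_integral_add, measurable)
         (simp add: nn_integral_cmult_indicator sets_\<mu>)
    also have "\<dots> \<le> ennreal (2 powr q) * (ennreal (2 * (C\<^sub>\<mu> * (4 * Z) powr q)) + ennreal R * ennreal (C\<^sub>\<mu> * L powr q))"
    proof (intro mult_left_mono add_mono integral)
      have "\<Omega> \<subseteq> ball x\<^sub>J (2 * D)"
        using dist_le_D[OF center] D_pos by fastforce
      then have "emeasure \<mu> \<Omega> \<le> emeasure \<mu> (ball x\<^sub>J (2 * D))"
        by (intro emeasure_mono) (simp_all add: sets_\<mu>)
      also have "\<dots> \<le> ennreal (C\<^sub>\<mu> * (2 * D) powr (q * (s * (DIM('a) - \<delta>))))"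
        using D_pos by (intro growth) auto
      also have "\<dots> \<le> ennreal (C\<^sub>\<mu> * L powr q)"
      proof (intro ennreal_leI mult_left_mono)
        have "(2 * D) powr (q * (s * (DIM('a) - \<delta>))) = ((2 * D) powr (s * (DIM('a) - \<delta>))) powr q"
          by (simp add: powr_powr mult.commute)
        also have "\<dots> \<le> (\<Lambda> powr (s * (DIM('a) - \<delta>))) powr q"
          using D_pos q \<beta>_nonneg by (intro powr_mono2) (auto simp: \<Lambda>_def)
        also have "\<dots> \<le> L powr q"
          unfolding L_def using q s_le \<beta>_nonneg by (intro powr_mono2 \<Lambda>_powr_le) auto
        finally show "(2 * D) powr (q * (s * (DIM('a) - \<delta>))) \<le> L powr q" .
      qed (use C\<^sub>\<mu> in simp)
      finally show "emeasure \<mu> \<Omega> \<le> ennreal (C\<^sub>\<mu> * L powr q)" .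
    qed simp_all
    also have "\<dots> = ennreal (2 powr q * (2 * (C\<^sub>\<mu> * (4 * Z) powr q) + R * (C\<^sub>\<mu> * L powr q)))"
      using C\<^sub>\<mu> by (simp add: R_def ennreal_mult[symmetric] ennreal_plus[symmetric] del: ennreal_plus)
    also have "\<dots> \<le> ennreal ((trace_const C\<^sub>\<mu> * (1 - \<delta>) * p) powr q)"
    proof (rule ennreal_leI)
      \<comment> \<open>Factors that are at least 1 are absorbed into q-th powers, so that the final
        q-th root leaves a constant free of q.\<close>
      have Cq: "C\<^sub>\<mu> \<le> C\<^sub>\<mu> powr q" using C\<^sub>\<mu> q powr_mono[of 1 q C\<^sub>\<mu>] by simp
      have "2 \<le> 2 powr q" using q powr_mono[of 1 q "2::real"] by simp
      have "2 * (C\<^sub>\<mu> * (4 * Z) powr q) \<le> 2 powr q * (C\<^sub>\<mu> powr q * (4 * Z) powr q)"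
        using Cq \<open>2 \<le> 2 powr q\<close> C\<^sub>\<mu> by (intro mult_mono) auto
      then have 1: "2 powr q * (2 * (C\<^sub>\<mu> * (4 * Z) powr q)) \<le> (16 * C\<^sub>\<mu> * Z) powr q"
      proof -
        have "2 powr q * (2 * (C\<^sub>\<mu> * (4 * Z) powr q)) \<le> 2 powr q * (2 powr q * (C\<^sub>\<mu> powr q * (4 * Z) powr q))"
          using \<open>2 * (C\<^sub>\<mu> * (4 * Z) powr q) \<le> _\<close> by (intro mult_left_mono) auto
        also have "\<dots> = (2 * (2 * (C\<^sub>\<mu> * (4 * Z)))) powr q"
          by (simp only: powr_mult)
        finally show ?thesis by (simp add: mult_ac)
      qed
      have "2 powr q * (R * (C\<^sub>\<mu> * L powr q)) \<le> 2 powr q * (R * (C\<^sub>\<mu> powr q * L powr q))"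
        using Cq by (intro mult_left_mono mult_right_mono) (auto simp: R_def)
      also have "\<dots> = (2 * ((8 * L * Z / \<rho>) * (C\<^sub>\<mu> * L))) powr q"
        by (simp only: R_def powr_mult)
      also have "2 * ((8 * L * Z / \<rho>) * (C\<^sub>\<mu> * L)) = 16 * C\<^sub>\<mu> * Z * (L * L / \<rho>)"
        by simp
      finally have 2: "2 powr q * (R * (C\<^sub>\<mu> * L powr q)) \<le> (16 * C\<^sub>\<mu> * Z * (L * L / \<rho>)) powr q" .
      have "2 powr q * (2 * (C\<^sub>\<mu> * (4 * Z) powr q) + R * (C\<^sub>\<mu> * L powr q))
          \<le> (16 * C\<^sub>\<mu> * Z) powr q + (16 * C\<^sub>\<mu> * Z * (L * L / \<rho>)) powr q"
        using 1 2 by (simp add: distrib_left)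
      also have "\<dots> \<le> (16 * C\<^sub>\<mu> * Z + 16 * C\<^sub>\<mu> * Z * (L * L / \<rho>)) powr q"
        using C\<^sub>\<mu> Z L \<rho> by (intro powr_add_le_powr_add q) auto
      also have "16 * C\<^sub>\<mu> * Z + 16 * C\<^sub>\<mu> * Z * (L * L / \<rho>) = trace_const C\<^sub>\<mu> * (1 - \<delta>) * p"
      proof -
        have "16 * C\<^sub>\<mu> * Z + 16 * C\<^sub>\<mu> * Z * w = 16 * C\<^sub>\<mu> * \<kappa> * (1 + w) * (1 - \<delta>) * p" for w
          by (simp add: Z_def algebra_simps)
        then show ?thesis by (simp only: trace_const_def L_def \<rho>_def)
      qed
      finally show "2 powr q * (2 * (C\<^sub>\<mu> * (4 * Z) powr q) + R * (C\<^sub>\<mu> * L powr q))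
          \<le> (trace_const C\<^sub>\<mu> * (1 - \<delta>) * p) powr q" .
    qed
    finally have main: "(\<integral>\<^sup>+x\<in>Lebesgue_points \<Omega> f. ennreal (\<bar>precise_rep f x - mean_on \<Omega> f\<bar> powr q) \<partial>\<mu>)
        \<le> ennreal ((trace_const C\<^sub>\<mu> * (1 - \<delta>) * p) powr q)" (is "?I \<le> _") .
    have T: "0 \<le> trace_const C\<^sub>\<mu> * (1 - \<delta>)"
      using trace_const_pos[of C\<^sub>\<mu>] C\<^sub>\<mu> \<delta> by simp
    have "?I \<noteq> \<infinity>" using main by (auto simp: top_unique)
    moreover have "enn2real ?I \<le> (trace_const C\<^sub>\<mu> * (1 - \<delta>) * p) powr q"
      using main by (intro enn2real_leI) auto
    then have "enn2real ?I powr (1 / q) \<le> ((trace_const C\<^sub>\<mu> * (1 - \<delta>) * p) powr q) powr (1 / q)"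
      using q by (intro powr_mono2) auto
    then have "enn2real ?I powr (1 / q) \<le> trace_const C\<^sub>\<mu> * (1 - \<delta>) * p"
      using q T p(1) by (simp add: powr_powr)
    ultimately have "ennreal_powr ?I (1 / q) \<le> ennreal (trace_const C\<^sub>\<mu> * (1 - \<delta>) * p)"
      unfolding ennreal_powr_def by (simp add: ennreal_leI)
    also have "\<dots> = ennreal (trace_const C\<^sub>\<mu> * (1 - \<delta>)) * ennreal p"
      by (rule ennreal_mult[OF T p(1)])
    finally show ?thesis
      unfolding John_energy_eq[OF fg] p(2) .
  qed
qed

end

theorem theorem1p5:
  fixes \<tau> s C\<^sub>\<mu> C\<^sub>J D :: real
  assumes "CARD('n::finite) \<ge> 2"
    and "0 < \<tau>" and "\<tau> < 1" and "1 \<le> s" and "1 \<le> C\<^sub>\<mu>" and "1 \<le> C\<^sub>J"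
  shows "\<exists>C>0. \<forall>(\<delta>::real) (q::real) (\<alpha>::real) (\<Omega>::(real^'n) set) (x\<^sub>J::real^'n)
      (\<mu>::(real^'n) measure) (f::real^'n \<Rightarrow> real).
      0 < \<delta> \<and> \<delta> < 1 \<and>
      s \<le> real CARD('n) / (real CARD('n) - \<delta>) \<and>
      1 \<le> q \<and> q \<le> real CARD('n) / (s * (real CARD('n) - \<delta>)) \<and>
      \<alpha> = real CARD('n) - q * s * (real CARD('n) - \<delta>) \<and>
      distance_John_domain s C\<^sub>J x\<^sub>J \<Omega> \<and> diameter \<Omega> = D \<and>
      Radon_measure \<mu> \<and>
      (\<forall>x r. 0 < r \<longrightarrow>
         emeasure \<mu> (ball x r) \<le> ennreal (C\<^sub>\<mu> * r powr (real CARD('n) - \<alpha>))) \<and>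
      set_integrable lebesgue \<Omega> f \<longrightarrow>
      ennreal_powr
        (\<integral>\<^sup>+x\<in>Lebesgue_points \<Omega> f. ennreal (\<bar>precise_rep f x - mean_on \<Omega> f\<bar> powr q) \<partial>\<mu>)
        (1 / q)
      \<le> ennreal (C * (1 - \<delta>)) *
        (\<integral>\<^sup>+y\<in>\<Omega>.
          (\<integral>\<^sup>+x\<in>{x\<in>\<Omega>. norm (x - y) < \<tau> * bdist \<Omega> y}.
             ennreal (\<bar>f x - f y\<bar> / norm (x - y) powr (real CARD('n) + \<delta>)) \<partial>lebesgue)
          \<partial>lebesgue)"
proof -
  let ?T = "John_domain.trace_const TYPE(real^'n) s C\<^sub>J D \<tau> C\<^sub>\<mu>"
  \<comment> \<open>The constant is chosen before any domain is given, whereas its positivity is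
    proved inside the locale, where a domain forces D > 0. The default 1 covers values of
    \<open>D\<close> for which it may fail.\<close>
  define C where "C = (if 0 < ?T then ?T else 1)"
  show ?thesis
  proof (intro exI[of _ C] conjI allI impI)
    show "0 < C" by (simp add: C_def)
    fix \<delta> q \<alpha> :: real and \<Omega> :: "(real^'n) set" and x\<^sub>J :: "real^'n"
      and \<mu> :: "(real^'n) measure" and f :: "real^'n \<Rightarrow> real"
    assume "0 < \<delta> \<and> \<delta> < 1 \<and>
      s \<le> real CARD('n) / (real CARD('n) - \<delta>) \<and>
      1 \<le> q \<and> q \<le> real CARD('n) / (s * (real CARD('n) - \<delta>)) \<and>
      \<alpha> = real CARD('n) - q * s * (real CARD('n) - \<delta>) \<and>
      distance_John_domain s C\<^sub>J x\<^sub>J \<Omega> \<and> diameter \<Omega> = D \<and>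
      Radon_measure \<mu> \<and>
      (\<forall>x r. 0 < r \<longrightarrow>
         emeasure \<mu> (ball x r) \<le> ennreal (C\<^sub>\<mu> * r powr (real CARD('n) - \<alpha>))) \<and>
      set_integrable lebesgue \<Omega> f"
    then have \<delta>: "0 < \<delta>" "\<delta> < 1" and s: "s \<le> real CARD('n) / (real CARD('n) - \<delta>)" and q: "1 \<le> q"
      and \<alpha>: "\<alpha> = real CARD('n) - q * s * (real CARD('n) - \<delta>)"
      and J: "distance_John_domain s C\<^sub>J x\<^sub>J \<Omega>" "diameter \<Omega> = D"
      and \<mu>: "Radon_measure \<mu>"
        "\<And>x r. 0 < r \<Longrightarrow> emeasure \<mu> (ball x r) \<le> ennreal (C\<^sub>\<mu> * r powr (real CARD('n) - \<alpha>))"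
      and f: "set_integrable lebesgue \<Omega> f"
      by auto
    have n: "0 < real CARD('n) - \<delta>" using assms(1) \<delta> by linarith
    then have "s * (real CARD('n) - \<delta>) \<le> real CARD('n)"
      using s by (simp add: pos_le_divide_eq)
    then interpret John_domain \<Omega> x\<^sub>J s C\<^sub>J D \<tau> \<delta>
      using J assms(2,3) \<delta> by unfold_locales auto
    have "C = trace_const C\<^sub>\<mu>"
      using trace_const_pos[of C\<^sub>\<mu>] assms(5) by (simp add: C_def)
    moreover have "real CARD('n) - \<alpha> = q * (s * (real DIM(real^'n) - \<delta>))"
      by (simp add: \<alpha>)
    ultimately show "ennreal_powr
        (\<integral>\<^sup>+x\<in>Lebesgue_points \<Omega> f. ennreal (\<bar>precise_rep f x - mean_on \<Omega> f\<bar> powr q) \<partial>\<mu>)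
        (1 / q)
      \<le> ennreal (C * (1 - \<delta>)) *
        (\<integral>\<^sup>+y\<in>\<Omega>.
          (\<integral>\<^sup>+x\<in>{x\<in>\<Omega>. norm (x - y) < \<tau> * bdist \<Omega> y}.
             ennreal (\<bar>f x - f y\<bar> / norm (x - y) powr (real CARD('n) + \<delta>)) \<partial>lebesgue)
          \<partial>lebesgue)"
      using trace_inequality[OF _ assms(5) q _ f, of \<mu>] \<mu> by (simp add: Radon_measure_def)
  qed
qed

end
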